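(* Assume $\Delta=\sum_{j=1}^q B_j-\sum_{k=1}^p A_k=0$ and $\mu=-m$ for some $m\in\mathbb{N}_0$. Let $\gamma=-\min_{1\le k\le p}(a_k/A_k)$. Then the Mellin transform of the H function exists in the half-plane $\Re s>\gamma$ and $$\int_0^\rho H_{q,p}^{p,0}\left(x \,\middle|\, \begin{array}{c}(\mathbf{B},\mathbf{b})\\(\mathbf{A},\mathbf{a})\end{array}\right)x^{s-1}\,dx=\frac{\prod_{k=1}^p\Gamma(A_ks+a_k)}{\prod_{j=1}^q\Gamma(B_js+b_j)}-\nu\rho^s\sum_{k=0}^m l_{m-k}s^k,\qquad \Re s>\gamma.$$
   Context: Let $p,q\in\mathbb{N}$, $\mathbf{A}=(A_1,\dots,A_p)$, $\mathbf{B}=(B_1,\dots,B_q)$ have positive entries and $\mathbf{a}=(a_1,\dots,a_p)$, $\mathbf{b}=(b_1,\dots,b_q)$ be real vectors. Define $\rho=\prod_{k=1}^pA_k^{A_k}\prod_{j=1}^qB_j^{-B_j}$, $\mu=\sum_{j=1}^q b_j-\sum_{k=1}^p a_k+\frac{p-q}{2}$, and $\nu=(2\pi)^{(p-q)/2}\prod_{k=1}^pA_k^{a_k-1/2}\prod_{j=1}^qB_j^{1/2-b_j}$. For $0<x<\rho$ Fox's H function is $$H_{q,p}^{p,0}\left(x \,\middle|\, \begin{array}{c}(\mathbf{B},\mathbf{b})\\(\mathbf{A},\mathbf{a})\end{array}\right)=\frac{1}{2\pi i}\int_{\mathcal{L}_{-\infty}}\frac{\prod_{k=1}^p\Gamma(A_ks+a_k)}{\prod_{j=1}^q\Gamma(B_js+b_j)}x^{-s}\,ds,$$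 where $\mathcal{L}_{-\infty}$ is a loop lying in a horizontal strip, starting at $-\infty+i\varphi_1$ and ending at $-\infty+i\varphi_2$ ($\varphi_1<\varphi_2$), leaving all poles of the integrand on its left. Bernoulli polynomials $\mathcal{B}_n(a)$: $\frac{te^{at}}{e^t-1}=\sum_{n\ge0}\mathcal{B}_n(a)\frac{t^n}{n!}$. The numbers $l_r$: $l_0=1$, $l_r=\frac1r\sum_{m'=1}^r q_{m'} l_{r-m'}$ for $r\ge1$, where $q_{m'}=\frac{(-1)^{m'+1}}{m'+1}\Big[\sum_{k=1}^p\frac{\mathcal{B}_{m'+1}(a_k)}{A_k^{m'}}-\sum_{j=1}^q\frac{\mathcal{B}_{m'+1}(b_j)}{B_j^{m'}}\Big]$. *)

theory Defs
  imports "HOL-Complex_Analysis.Complex_Analysis" "HOL-Computational_Algebra.Formal_Power_Series"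
begin

definition bernoulli_poly :: "nat \<Rightarrow> real \<Rightarrow> real" where
  "bernoulli_poly n a = fact n * fps_nth (fps_X * fps_exp a / (fps_exp 1 - 1)) n"

(* Parameters: vectors are functions on indices 0..<p (resp. 0..<q). *)

definition H_rho :: "nat \<Rightarrow> nat \<Rightarrow> (nat \<Rightarrow> real) \<Rightarrow> (nat \<Rightarrow> real) \<Rightarrow> real" where
  "H_rho p q A B = (\<Prod>k<p. A k powr A k) * (\<Prod>j<q. B j powr (- B j))"

definition H_mu :: "nat \<Rightarrow> nat \<Rightarrow> (nat \<Rightarrow> real) \<Rightarrow> (nat \<Rightarrow> real) \<Rightarrow> real" where
  "H_mu p q a b = (\<Sum>j<q. b j) - (\<Sum>k<p. a k) + (real p - real q) / 2"

definition H_nu :: "nat \<Rightarrow> nat \<Rightarrow> (nat \<Rightarrow> real) \<Rightarrow> (nat \<Rightarrow> real) \<Rightarrow> (nat \<Rightarrow> real) \<Rightarrow> (nat \<Rightarrow> real) \<Rightarrow> real" where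
  "H_nu p q A a B b = (2 * pi) powr ((real p - real q) / 2)
     * (\<Prod>k<p. A k powr (a k - 1/2)) * (\<Prod>j<q. B j powr (1/2 - b j))"

definition H_qcoef :: "nat \<Rightarrow> nat \<Rightarrow> (nat \<Rightarrow> real) \<Rightarrow> (nat \<Rightarrow> real) \<Rightarrow> (nat \<Rightarrow> real) \<Rightarrow> (nat \<Rightarrow> real) \<Rightarrow> nat \<Rightarrow> real" where
  "H_qcoef p q A a B b m' = (-1) ^ (m' + 1) / real (m' + 1) *
     ((\<Sum>k<p. bernoulli_poly (m' + 1) (a k) / A k ^ m') - (\<Sum>j<q. bernoulli_poly (m' + 1) (b j) / B j ^ m'))"

function H_lcoef :: "nat \<Rightarrow> nat \<Rightarrow> (nat \<Rightarrow> real) \<Rightarrow> (nat \<Rightarrow> real) \<Rightarrow> (nat \<Rightarrow> real) \<Rightarrow> (nat \<Rightarrow> real) \<Rightarrow> nat \<Rightarrow> real" where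
  "H_lcoef p q A a B b r = (if r = 0 then 1 else
     (1 / real r) * (\<Sum>m'\<in>{1..r}. H_qcoef p q A a B b m' * H_lcoef p q A a B b (r - m')))"
  by pat_completeness auto
termination by (relation "Wellfounded.measure (\<lambda>(p,q,A,a,B,b,r). r)") auto

definition H_kernel :: "nat \<Rightarrow> nat \<Rightarrow> (nat \<Rightarrow> real) \<Rightarrow> (nat \<Rightarrow> real) \<Rightarrow> (nat \<Rightarrow> real) \<Rightarrow> (nat \<Rightarrow> real) \<Rightarrow> complex \<Rightarrow> complex" where
  "H_kernel p q A a B b s =
     (\<Prod>k<p. Gamma (of_real (A k) * s + of_real (a k))) * (\<Prod>j<q. rGamma (of_real (B j) * s + of_real (b j)))"

(* gamma = - min_k a_k/A_k : all poles of the integrand are real and \<le> gamma *)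
definition H_gamma :: "nat \<Rightarrow> (nat \<Rightarrow> real) \<Rightarrow> (nat \<Rightarrow> real) \<Rightarrow> real" where
  "H_gamma p A a = - Min ((\<lambda>k. a k / A k) ` {..<p})"

definition trunc_loop :: "real \<Rightarrow> real \<Rightarrow> real \<Rightarrow> real \<Rightarrow> real \<Rightarrow> complex" where
  "trunc_loop c phi1 phi2 R =
     linepath (Complex (-R) phi1) (Complex c phi1) +++
     (linepath (Complex c phi1) (Complex c phi2) +++ linepath (Complex c phi2) (Complex (-R) phi2))"

(* Fox's H function H^{p,0}_{q,p}: the loop integral over L_{-infinity}, realised with the loop
   consisting of the rays Im s = -1 and Im s = 1 (Re s \<le> gamma + 1) joined by the vertical segment
   Re s = gamma + 1, as the limit of truncated loops. *)
definition FoxH :: "nat \<Rightarrow> nat \<Rightarrow> (nat \<Rightarrow> real) \<Rightarrow> (nat \<Rightarrow> real) \<Rightarrow> (nat \<Rightarrow> real) \<Rightarrow> (nat \<Rightarrow> real) \<Rightarrow> real \<Rightarrow> complex" where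
  "FoxH p q A a B b x =
     Lim at_top (\<lambda>R. contour_integral (trunc_loop (H_gamma p A a + 1) (-1) 1 R)
                       (\<lambda>s. H_kernel p q A a B b s * of_real x powr (- s)))
     / (2 * pi * \<i>)"

end

theory Submission
  imports Defs
begin

text \<open>
  Stirling's expansion of \<open>Gamma (z + a)\<close> follows from the functional equation alone: the truncated
  expansion of the logarithm fails the difference equation by \<open>O(z ^ (- n - 2))\<close>, because the
  Bernoulli polynomials make the lower coefficients cancel, and the error is the sum of these
  defects over \<open>z, z + 1, z + 2, \<dots>\<close>. It is small in the sector \<open>Re z \<ge> - \<bar>Im z\<bar>\<close> and bounded for
  \<open>\<bar>Im z\<bar> \<ge> \<delta>\<close>, also far to the left. If \<open>\<Delta> = 0\<close> and \<open>\<mu> = - m\<close>, the kernel is therefore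
  \<open>\<rho> powr s * (\<nu> * (\<Sum>i\<le>m. l (m - i) * s ^ i) + k(s))\<close> with \<open>k(s) = O(1 / s)\<close> in the sector.

  The polynomial part contributes nothing to the loop integral, and the loop can be opened up to two
  rays in the sector, starting at \<open>d < Re s\<close>. On these rays \<open>k(w) / (Re s - Re w)\<close> is
  absolutely integrable, so Fubini's theorem turns the Mellin transform into
  \<open>\<rho> powr s\<close> times the integral of \<open>k(w) / (s - w)\<close> over the rays, which is \<open>2 * pi * \<i> * k(s)\<close> by
  Cauchy's formula. Contours are compared throughout by means of primitives in the plane slit along
  \<open>(-\<infinity>, \<gamma>]\<close>.
\<close>

section \<open>Stirling's expansion with Bernoulli polynomials\<close>

text \<open>Fubini's theorem is out of reach on the loop that defines \<open>FoxH\<close>. Its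
  horizontal rays run beside the poles, where k is only known to be \<open>O(s ^ m)\<close>.
  Convergence there rests on the factor \<open>exp (- R * L)\<close> with
  \<open>L = ln \<rho> - ln x\<close>, and the resulting bound of size \<open>L ^ (- m - 1)\<close>
  is not integrable at \<open>x = \<rho>\<close>. On tilted rays k decays, and integrating over x
  first supplies a second decaying factor \<open>1 / (s - w)\<close>.

  The sector bound requires each Gamma factor up to a relative error
  \<open>O(s ^ (- m - 1))\<close>, because this error is multiplied by \<open>s ^ m\<close>. Far to
  the left an expansion of order 0 is enough: it only has to show that the vertical pieces between
  the loop and the rays vanish in the limit. Since \<open>- \<mu>\<close> is a natural number, the
  leading power \<open>s ^ m\<close> has no branch point, so the main part is entire and there is
  nothing for the loop to enclose.\<close>

text \<open>Coefficient of \<open>t ^ (n + 1)\<close> in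
  \<open>(exp t - 1) * G(t) = t * exp (a * t)\<close>, multiplied by \<open>(n + 1)!\<close>. The
  Stirling expansion rests on no other fact about Bernoulli polynomials.\<close>

lemma bernoulli_poly_sum:
  "(\<Sum>i\<le>n. real (Suc n choose i) * bernoulli_poly i a) = real (Suc n) * a ^ n"
proof -
  define G :: "real fps" where "G = fps_X * fps_exp a / (fps_exp 1 - 1)"
  have sd: "subdegree (fps_exp 1 - 1 :: real fps) = 1"
    by (rule subdegreeI) auto
  \<comment> \<open>The divisor has no constant term, so the quotient in
    \<open>bernoulli_poly\<close> is a true quotient only after divisibility is checked; comparing
    subdegrees does this.\<close>
  have "(fps_exp 1 - 1) dvd (fps_X * fps_exp a :: real fps)"
    using sd by (subst fps_dvd_iff) (force simp: subdegree_mult)+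
  hence G: "(fps_exp 1 - 1) * G = fps_X * fps_exp a"
    unfolding G_def by (metis dvd_mult_div_cancel)
  have "fps_nth ((fps_exp 1 - 1) * G) (Suc n) =
      (\<Sum>i\<le>n. fps_nth G i / fact (Suc n - i))"
  proof -
    have "fps_nth ((fps_exp 1 - 1) * G) (Suc n) = fps_nth (G * (fps_exp 1 - 1)) (Suc n)"
      by (simp add: mult.commute)
    also have "\<dots> = (\<Sum>i\<le>Suc n. fps_nth G i * fps_nth (fps_exp 1 - 1) (Suc n - i))"
      by (simp add: fps_mult_nth atLeast0AtMost)
    also have "\<dots> = (\<Sum>i\<le>n. fps_nth G i * fps_nth (fps_exp 1 - 1) (Suc n - i))"
      by simp
    also have "\<dots> = (\<Sum>i\<le>n. fps_nth G i / fact (Suc n - i))"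
      by (intro sum.cong) (auto simp: Suc_diff_le simp del: fact_Suc)
    finally show ?thesis .
  qed
  also have "fps_nth ((fps_exp 1 - 1) * G) (Suc n) = a ^ n / fact n"
    by (subst G) simp
  finally have eq: "(\<Sum>i\<le>n. fps_nth G i / fact (Suc n - i)) = a ^ n / fact n" ..
  have "(\<Sum>i\<le>n. real (Suc n choose i) * bernoulli_poly i a) =
        (\<Sum>i\<le>n. fact (Suc n) * (fps_nth G i / fact (Suc n - i)))"
    by (intro sum.cong refl)
       (auto simp: bernoulli_poly_def G_def [symmetric] binomial_fact field_simps simp del: binomial_Suc_Suc fact_Suc)
  also have "\<dots> = fact (Suc n) * (a ^ n / fact n)"
    by (subst sum_distrib_left [symmetric], subst eq) simp
  also have "\<dots> = real (Suc n) * a ^ n" by simp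
  finally show ?thesis .
qed

lemma bernoulli_poly_0: "bernoulli_poly 0 a = 1"
  using bernoulli_poly_sum [of 0 a] by simp

lemma bernoulli_poly_1: "bernoulli_poly (Suc 0) a = a - 1 / 2"
  using bernoulli_poly_sum [of 1 a] by (simp add: bernoulli_poly_0)

text \<open>Dividing by \<open>X ^ n\<close> leaves a series that is continuous, hence bounded, near
  0. With \<open>w = 1 / z\<close> this converts identities between coefficients into O-estimates
  for large z.\<close>

lemma has_fps_expansion_imp_bound:
  fixes f :: "complex \<Rightarrow> complex"
  assumes f: "f has_fps_expansion F" and z: "\<And>i. i < n \<Longrightarrow> fps_nth F i = 0"
  obtains r C where "r > 0" "C \<ge> 0" "\<And>w. norm w < r \<Longrightarrow> norm (f w) \<le> C * norm w ^ n"
proof -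
  define G where "G = fps_shift n F"
  have F: "F = fps_X ^ n * G"
    using z by (auto simp: fps_eq_iff G_def fps_X_power_mult_nth)
  have rad: "fps_conv_radius F > 0" and ev: "eventually (\<lambda>w. eval_fps F w = f w) (nhds 0)"
    using f by (auto simp: has_fps_expansion_def)
  have radG: "fps_conv_radius G > 0" using rad by (simp add: G_def)
  have "continuous (at 0) (eval_fps G)"
    using radG by (intro continuous_eval_fps) (auto simp: zero_ereal_def)
  hence lim: "(eval_fps G \<longlongrightarrow> eval_fps G 0) (nhds 0)"
    by (simp add: continuous_at tendsto_at_iff_tendsto_nhds)
  have "eventually (\<lambda>w. dist (eval_fps G w) (eval_fps G 0) < 1) (nhds 0)"
    using lim by (rule tendstoD) simp
  moreover have "eventually (\<lambda>w. w \<in> eball 0 (fps_conv_radius G)) (nhds (0::complex))"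
    using radG by (intro eventually_nhds_in_open) (auto simp: zero_ereal_def)
  ultimately have "eventually (\<lambda>w. norm (f w) \<le> (norm (eval_fps G 0) + 1) * norm w ^ n) (nhds 0)"
    using ev
  proof eventually_elim
    case (elim w)
    have "norm (eval_fps G w) \<le> norm (eval_fps G 0) + 1"
      using elim(1) norm_triangle_ineq2 [of "eval_fps G w" "eval_fps G 0"] by (simp add: dist_norm)
    moreover have "f w = w ^ n * eval_fps G w"
      using elim by (subst elim(3) [symmetric], subst F, subst eval_fps_mult) (auto simp: )
    ultimately show ?case
      by (simp add: norm_mult norm_power mult.commute [of _ "norm w ^ n"] mult_left_mono)
  qed
  then obtain r where "r > 0" "\<And>w. dist w 0 < r \<Longrightarrow> norm (f w) \<le> (norm (eval_fps G 0) + 1) * norm w ^ n"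
    unfolding eventually_nhds_metric by blast
  thus ?thesis by (intro that [of r "norm (eval_fps G 0) + 1"]) auto
qed

lemma has_fps_expansion_Ln_one_plus:
  fixes c :: complex
  shows "(\<lambda>w. Ln (1 + c * w)) has_fps_expansion Abs_fps (\<lambda>n. if n = 0 then 0 else - ((- c) ^ n / of_nat n))"
proof (rule has_fps_expansionI)
  have "eventually (\<lambda>w. w \<in> ball 0 (inverse (norm c + 1))) (nhds (0::complex))"
    by (intro eventually_nhds_in_open) (auto simp: add_nonneg_pos)
  then show "\<forall>\<^sub>F u in nhds 0. (\<lambda>n. fps_nth (Abs_fps (\<lambda>n. if n = 0 then 0 else - ((- c) ^ n / of_nat n))) n * u ^ n)
              sums Ln (1 + c * u)"
  proof eventually_elim
    case (elim w)
    have "norm (c * w) \<le> norm c * inverse (norm c + 1)"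
      unfolding norm_mult using elim by (intro mult_left_mono) auto
    also have "\<dots> < 1" by (simp add: divide_simps add_nonneg_pos)
    finally have "(\<lambda>n. (-1)^Suc n / of_nat n * (c * w)^n) sums ln (1 + c * w)"
      by (rule Ln_series)
    also have "(\<lambda>n. (-1)^Suc n / of_nat n * (c * w)^n) =
      (\<lambda>n. fps_nth (Abs_fps (\<lambda>n. if n = 0 then 0 else - ((- c) ^ n / of_nat n))) n * w ^ n)"
      by (auto simp: fun_eq_iff power_minus' field_simps)
    finally show ?case .
  qed
qed

text \<open>The two sides could differ by a multiple of \<open>2 * pi * \<i>\<close>. Adding a real
  number does not change the sign of the imaginary part, so the arguments of z and
  \<open>z + a\<close> differ by less than pi.\<close>

lemma Ln_add_of_real:
  assumes "z \<notin> \<real>\<^sub>\<le>\<^sub>0" "z + of_real a \<notin> \<real>\<^sub>\<le>\<^sub>0"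
  shows "Ln (z + of_real a) = Ln z + Ln (1 + of_real a * (1 / z))"
proof -
  have nz: "z \<noteq> 0" "z + of_real a \<noteq> 0" using assms by auto
  define d where "d = Ln (z + of_real a) - Ln z"
  have "Im d > -pi \<and> Im d < pi"
  proof (cases "Im z" "0::real" rule: linorder_cases)
    case greater
    hence "0 < Im (Ln z)" "Im (Ln z) < pi" "0 < Im (Ln (z + of_real a))" "Im (Ln (z + of_real a)) < pi"
      by (auto simp: Im_Ln_pos_lt_imp)
    thus ?thesis by (auto simp: d_def)
  next
    case less
    hence "-pi < Im (Ln z)" "Im (Ln z) < 0" "-pi < Im (Ln (z + of_real a))" "Im (Ln (z + of_real a)) < 0"
      using nz Im_Ln_le_pi [of z] Im_Ln_le_pi [of "z + of_real a"] mpi_less_Im_Ln [of z]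
        mpi_less_Im_Ln [of "z + of_real a"] Im_Ln_pos_le [of z] Im_Ln_pos_le [of "z + of_real a"]
      by auto
    thus ?thesis by (auto simp: d_def)
  next
    case equal
    hence "z \<in> \<real>" "z + of_real a \<in> \<real>" by (auto simp: complex_is_Real_iff)
    hence "Im (Ln z) = 0" "Im (Ln (z + of_real a)) = 0"
      using assms nz equal by (auto simp: Im_Ln_eq_0 complex_nonpos_Reals_iff)
    thus ?thesis by (auto simp: d_def)
  qed
  hence "Ln (exp d) = d" by (intro Ln_exp) auto
  moreover have "exp d = 1 + of_real a * (1 / z)"
    using nz by (simp add: d_def exp_diff field_simps)
  ultimately show ?thesis by (simp add: d_def)
qed

section \<open>The truncated Stirling series and its defect\<close>

text \<open>The coefficient of \<open>1 / z ^ k\<close> in the asymptotic series of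
  \<open>ln Gamma (z + a)\<close>.\<close>

definition stirling_coeff :: "real \<Rightarrow> nat \<Rightarrow> real" where
  "stirling_coeff a k = (-1) ^ (k + 1) * bernoulli_poly (k + 1) a / (real k * real (k + 1))"

text \<open>The expansion is in powers of z, not of \<open>z + a\<close>, so that after
  \<open>z = A k * s\<close> the contributions of different factors can be added
  coefficientwise.\<close>

definition ln_Gamma_approx :: "real \<Rightarrow> nat \<Rightarrow> complex \<Rightarrow> complex" where
  "ln_Gamma_approx a n z = (z + of_real a - 1 / 2) * Ln z - z + of_real (ln (2 * pi) / 2)
     + (\<Sum>k=1..n. of_real (stirling_coeff a k) / z ^ k)"

definition ln_Gamma_defect :: "real \<Rightarrow> nat \<Rightarrow> complex \<Rightarrow> complex" where
  "ln_Gamma_defect a n z = ln_Gamma_approx a n (z + 1) - ln_Gamma_approx a n z - Ln (z + of_real a)"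

text \<open>These sums arise when \<open>1 / (z + 1) ^ k\<close> is expanded in powers of
  \<open>1 / z\<close>. Two absorption identities for binomials turn the summand into a term of
  \<open>bernoulli_poly_sum\<close>; the indices 0 and 1 missing there account for the elementary
  terms on the right.\<close>

lemma stirling_coeff_sum:
  assumes "j \<ge> 1"
  shows "(\<Sum>k=1..<j. (-1) ^ (j - k) * real ((j - 1) choose (k - 1)) * stirling_coeff a k) =
    (-1) ^ j * ((a + 1/2) / real j - 1 / real (j + 1) - a ^ j / real j)"
proof -
  have "(\<Sum>k=1..<j. (-1) ^ (j - k) * real ((j - 1) choose (k - 1)) * stirling_coeff a k) =
     (\<Sum>k=1..<j. - ((-1) ^ j) / (real j * real (j + 1)) * (real (Suc j choose Suc k) * bernoulli_poly (Suc k) a))"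
  proof (intro sum.cong refl, goal_cases)
    case (1 k)
    then obtain i where k: "k = Suc i" by (cases k) auto
    obtain l where j: "j = Suc l" using 1 by (cases j) auto
    have "real (j choose k) * real k = real j * real ((j - 1) choose (k - 1))"
      using Suc_times_binomial_eq [of l i] unfolding k j
      by (simp del: of_nat_Suc binomial_Suc_Suc flip: of_nat_mult)
    moreover have "real (Suc j choose Suc k) * real (Suc k) = real (Suc j) * real (j choose k)"
      using Suc_times_binomial_eq [of j k]
      by (simp del: of_nat_Suc binomial_Suc_Suc flip: of_nat_mult)
    ultimately have "real ((j - 1) choose (k - 1)) * (real (Suc j) * real j) =
        real (Suc j choose Suc k) * (real (Suc k) * real k)"
      by (metis (no_types, lifting) mult.assoc mult.commute)
    hence *: "real ((j - 1) choose (k - 1)) / (real k * real (Suc k)) =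
        real (Suc j choose Suc k) / (real j * real (Suc j))"
      using 1 by (simp add: divide_simps del: of_nat_Suc binomial_Suc_Suc) (simp add: mult_ac)
    have sgn: "(-1 :: real) ^ (j - k) * (-1) ^ (k + 1) = - ((-1) ^ j)"
      using 1 by (simp add: power_add [symmetric])
    have "(-1) ^ (j - k) * real ((j - 1) choose (k - 1)) * stirling_coeff a k =
       ((-1) ^ (j - k) * (-1) ^ (k + 1)) * (real ((j - 1) choose (k - 1)) / (real k * real (Suc k))) * bernoulli_poly (Suc k) a"
      by (simp add: stirling_coeff_def del: of_nat_Suc)
    also have "\<dots> = - ((-1) ^ j) / (real j * real (j + 1)) * (real (Suc j choose Suc k) * bernoulli_poly (Suc k) a)"
      unfolding sgn * by (simp del: of_nat_Suc binomial_Suc_Suc)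
    finally show ?case .
  qed
  also have "\<dots> = - ((-1) ^ j) / (real j * real (j + 1)) *
     (\<Sum>k=1..<j. real (Suc j choose Suc k) * bernoulli_poly (Suc k) a)"
    by (simp add: sum_distrib_left)
  also have "(\<Sum>k=1..<j. real (Suc j choose Suc k) * bernoulli_poly (Suc k) a) =
     (\<Sum>i=2..j. real (Suc j choose i) * bernoulli_poly i a)"
    using assms by (intro sum.reindex_bij_witness [of _ "\<lambda>i. i - 1" Suc]) auto
  also have "\<dots> = (\<Sum>i\<le>j. real (Suc j choose i) * bernoulli_poly i a) - 1 - real (Suc j) * (a - 1/2)"
  proof -
    have "{..j} = insert 0 (insert 1 {2..j})" using assms by auto
    thus ?thesis by (simp add: bernoulli_poly_0 bernoulli_poly_1)
  qed
  also have "(\<Sum>i\<le>j. real (Suc j choose i) * bernoulli_poly i a) = real (Suc j) * a ^ j"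
    by (rule bernoulli_poly_sum)
  also have "- ((-1) ^ j) / (real j * real (j + 1)) * (real (Suc j) * a ^ j - 1 - real (Suc j) * (a - 1/2)) =
      (-1) ^ j * ((a + 1/2) / real j - 1 / real (j + 1) - a ^ j / real j)"
    using assms by (simp add: divide_simps) (simp add: algebra_simps)
  finally show ?thesis .
qed


text \<open>With \<open>w = 1 / z\<close> the function \<open>w / (1 + w)\<close> is
  \<open>1 / (z + 1)\<close>. The case \<open>k = 0\<close> stands apart because of the natural
  subtraction \<open>k - 1\<close>.\<close>

lemma fps_nth_X_inverse_power:
  "fps_nth ((fps_X * inverse (1 + fps_X)) ^ k :: complex fps) j =
     (if j < k then 0 else if k = 0 then (if j = 0 then 1 else 0)
      else (-1) ^ (j - k) * of_nat ((j - 1) choose (k - 1)))"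
proof (cases "k = 0")
  case False
  have "(fps_X * inverse (1 + fps_X)) ^ k = fps_X ^ k * (fps_binomial (- of_nat k) :: complex fps)"
    by (simp add: power_mult_distrib fps_binomial_minus_of_nat fps_inverse_power)
  also have "fps_nth \<dots> j = (if j < k then 0 else (- of_nat k) gchoose (j - k))"
    by (simp add: fps_X_power_mult_nth)
  also have "\<dots> = (if j < k then 0 else (-1) ^ (j - k) * of_nat ((j - 1) choose (k - 1)))"
  proof (cases "j < k")
    case False
    have "(- of_nat k :: complex) gchoose (j - k) = (-1) ^ (j - k) * ((of_nat k + of_nat (j - k) - 1) gchoose (j - k))"
      by (rule gbinomial_minus)
    also have "of_nat k + of_nat (j - k) - 1 = (of_nat (j - 1) :: complex)"
      using False \<open>k \<noteq> 0\<close> by (simp add: of_nat_diff)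
    also have "of_nat (j - 1) gchoose (j - k) = (of_nat ((j - 1) choose (j - k)) :: complex)"
      by (rule binomial_gbinomial [symmetric])
    also have "(j - 1) choose (j - k) = (j - 1) choose (k - 1)"
      using False \<open>k \<noteq> 0\<close> by (subst binomial_symmetric) auto
    finally show ?thesis using False by simp
  qed auto
  finally show ?thesis using False by simp
qed auto

lemma ln_Gamma_defect_bound:
  obtains r C where "r \<ge> 1" "C \<ge> 0"
    "\<And>z. norm z \<ge> r \<Longrightarrow> z \<notin> \<real>\<^sub>\<le>\<^sub>0 \<Longrightarrow> z + of_real a \<notin> \<real>\<^sub>\<le>\<^sub>0 \<and> norm (ln_Gamma_defect a n z) \<le> C / norm z ^ (n + 2)"
proof -
  define L :: "complex \<Rightarrow> complex fps"
    where "L = (\<lambda>c. Abs_fps (\<lambda>n. if n = 0 then 0 else - ((- c) ^ n / of_nat n)))"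
  define c where "c = (\<lambda>k. complex_of_real (stirling_coeff a k))"
  \<comment> \<open>This is w times the defect at \<open>z = 1 / w\<close>. The three multiples of
    \<open>Ln z\<close> in the defect add up to zero, and what is left is analytic at
    \<open>w = 0\<close>.\<close>
  define e :: "complex \<Rightarrow> complex" where
    "e = (\<lambda>w. (1 + (of_real a + 1/2) * w) * Ln (1 + 1 * w) - w - w * Ln (1 + of_real a * w)
            + w * (\<Sum>k=1..n. c k * ((w * inverse (1 + w)) ^ k - w ^ k)))"
  define F where "F = (1 + fps_const (of_real a + 1/2) * fps_X) * L 1 - fps_X - fps_X * L (of_real a)
            + fps_X * (\<Sum>k=1..n. fps_const (c k) * ((fps_X * inverse (1 + fps_X)) ^ k - fps_X ^ k))"
  have pw: "(\<lambda>w::complex. (w * inverse (1 + w)) ^ k) has_fps_expansion (fps_X * inverse (1 + fps_X)) ^ k" for k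
    by (induction k) (simp_all add: has_fps_expansion_mult has_fps_expansion_inverse has_fps_expansion_add
      has_fps_expansion_fps_X)
  have L: "(\<lambda>w. Ln (1 + c * w)) has_fps_expansion L c" for c
    unfolding L_def by (rule has_fps_expansion_Ln_one_plus)
  have exp: "e has_fps_expansion F"
    unfolding e_def F_def
    by (intro has_fps_expansion_add has_fps_expansion_diff has_fps_expansion_mult has_fps_expansion_const
      has_fps_expansion_fps_X has_fps_expansion_1 L has_fps_expansion_sum pw has_fps_expansion_fps_X_power)
  \<comment> \<open>The order is \<open>n + 3\<close> instead of \<open>n + 2\<close> because of the
    extra factor w.\<close>
  have "fps_nth F i = 0" if "i < n + 3" for i
  proof (cases i)
    case 0
    thus ?thesis by (simp add: F_def L_def)
  next
    case (Suc j)
    \<comment> \<open>Here \<open>j \<le> n + 1\<close>, so every \<open>k < j\<close> lies within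
      the truncation. The term \<open>k = j\<close> cancels against \<open>w ^ k\<close>, and the
      terms with \<open>k > j\<close> start at a higher power.\<close>
    have sum: "(\<Sum>k=1..n. c k * (fps_nth ((fps_X * inverse (1 + fps_X)) ^ k) j - (if j = k then 1 else 0))) =
          (\<Sum>k=1..<j. of_real ((-1) ^ (j - k) * real ((j - 1) choose (k - 1)) * stirling_coeff a k))"
      using that Suc by (intro sum.mono_neutral_cong) (auto simp: fps_nth_X_inverse_power c_def)
    have F: "fps_nth F (Suc j) = fps_nth (L 1) (Suc j) + (of_real a + 1/2) * fps_nth (L 1) j
       - (if j = 0 then 1 else 0) - fps_nth (L (of_real a)) j +
       (\<Sum>k=1..<j. of_real ((-1) ^ (j - k) * real ((j - 1) choose (k - 1)) * stirling_coeff a k))"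
      unfolding sum [symmetric]
      by (simp add: F_def ring_distribs fps_sum_nth mult.assoc fps_X_power_nth)
    show ?thesis
    proof (cases "j = 0")
      case True
      thus ?thesis using Suc F by (simp add: L_def)
    next
      case False
      define T where "T = (\<Sum>k=1..<j. (-1) ^ (j - k) * real ((j - 1) choose (k - 1)) * stirling_coeff a k)"
      have T: "T = (-1) ^ j * ((a + 1/2) / real j - 1 / real (j + 1) - a ^ j / real j)"
        unfolding T_def using False by (intro stirling_coeff_sum) auto
      have "fps_nth F (Suc j) = of_real ((-1) ^ j * (1 / real (j + 1)) - (a + 1 / 2) * ((-1) ^ j / real j)
          + (- 1) ^ j * a ^ j / real j + T)"
      proof -
        have "fps_nth (L 1) (Suc j) = of_real ((-1) ^ j * (1 / real (j + 1)))"
          by (simp add: L_def add_ac)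
        moreover have "fps_nth (L 1) j = of_real (- ((-1) ^ j / real j))"
          using False by (simp add: L_def)
        moreover have "fps_nth (L (of_real a)) j = of_real (- ((- 1) ^ j * a ^ j / real j))"
          using False by (simp add: L_def power_minus [of "complex_of_real a"])
        ultimately show ?thesis using False unfolding F T_def by simp
      qed
      also have "(-1) ^ j * (1 / real (j + 1)) - (a + 1 / 2) * ((-1) ^ j / real j) + (- 1) ^ j * a ^ j / real j + T = 0"
        unfolding T by (simp add: algebra_simps add_divide_distrib diff_divide_distrib)
      also have "complex_of_real 0 = 0" by simp
      finally show ?thesis using Suc by simp
    qed
  qed
  from has_fps_expansion_imp_bound [OF exp this] obtain r C where r: "r > 0" "C \<ge> 0"
    and bd: "\<And>w. norm w < r \<Longrightarrow> norm (e w) \<le> C * norm w ^ (n + 3)" by blast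
  \<comment> \<open>Large enough that a shift by 1 or by a cannot carry z onto the cut, and that
    \<open>1 / z\<close> lies in the disc where e is controlled.\<close>
  define R where "R = 2 + \<bar>a\<bar> + 1 / r"
  have R1: "R \<ge> 1" using r by (simp add: R_def)
  have fin: "z + of_real a \<notin> \<real>\<^sub>\<le>\<^sub>0 \<and> norm (ln_Gamma_defect a n z) \<le> C / norm z ^ (n + 2)"
    if z: "norm z \<ge> R" "z \<notin> \<real>\<^sub>\<le>\<^sub>0" for z
  proof -
    define w where "w = 1 / z"
    have nz: "z \<noteq> 0" and pos: "norm z > 0" using z by auto
    have za: "z + of_real t \<notin> \<real>\<^sub>\<le>\<^sub>0" if "\<bar>t\<bar> < norm z" for t
    proof
      assume *: "z + of_real t \<in> \<real>\<^sub>\<le>\<^sub>0"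
      hence "Im z = 0" by (auto simp: complex_nonpos_Reals_iff)
      with z nz * that show False
        by (auto simp: complex_nonpos_Reals_iff cmod_eq_Re)
    qed
    have big: "norm z \<ge> 2 + \<bar>a\<bar> + 1 / r" "1 / r > 0" using z r by (auto simp: R_def)
    have a: "z + of_real a \<notin> \<real>\<^sub>\<le>\<^sub>0" using big by (intro za) linarith
    have one: "z + of_real 1 \<notin> \<real>\<^sub>\<le>\<^sub>0" using big by (intro za) linarith
    hence nz1: "z + 1 \<noteq> 0" by auto
    have Ln1: "Ln (z + 1) = Ln z + Ln (1 + 1 * w)"
      using Ln_add_of_real [OF z(2) one] by (simp add: w_def)
    have Lna: "Ln (z + of_real a) = Ln z + Ln (1 + of_real a * w)"
      using Ln_add_of_real [OF z(2) a] by (simp add: w_def)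
    have frac: "1 / (z + 1) = w * inverse (1 + w)"
      using nz nz1 by (simp add: w_def field_simps)
    have "ln_Gamma_defect a n z * w = e w"
    proof -
      have "ln_Gamma_defect a n z = ((z + of_real a + 1 / 2) * (Ln z + Ln (1 + 1 * w)) - (z + of_real a - 1 / 2) * Ln z - 1
          - (Ln z + Ln (1 + of_real a * w))) + ((\<Sum>k=1..n. c k / (z + 1) ^ k) - (\<Sum>k=1..n. c k / z ^ k))"
        unfolding ln_Gamma_defect_def ln_Gamma_approx_def Ln1 Lna c_def by (simp add: algebra_simps)
      also have "(\<Sum>k=1..n. c k / (z + 1) ^ k) - (\<Sum>k=1..n. c k / z ^ k) =
           (\<Sum>k=1..n. c k * ((w * inverse (1 + w)) ^ k - w ^ k))" (is "_ = ?S")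
        by (simp add: sum_subtractf [symmetric] ring_distribs power_divide frac [symmetric])
           (simp add: w_def power_divide)
      also have "(((z + of_real a + 1 / 2) * (Ln z + Ln (1 + 1 * w)) - (z + of_real a - 1 / 2) * Ln z - 1
          - (Ln z + Ln (1 + of_real a * w))) + ?S) * w = e w"
        using nz unfolding e_def by (simp add: w_def field_simps)
      finally show ?thesis .
    qed
    moreover have "norm w < r"
    proof -
      have "norm z > 1 / r" using big by linarith
      thus ?thesis using pos r by (simp add: w_def norm_divide field_simps)
    qed
    ultimately have "norm (ln_Gamma_defect a n z) * norm w \<le> C * norm w ^ (n + 3)"
      using bd [of w] by (metis norm_mult)
    hence "norm (ln_Gamma_defect a n z) \<le> C / norm z ^ (n + 2)"
      using pos by (simp add: w_def norm_divide power_divide field_simps power_numeral_reduce eval_nat_numeral)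
    with a show ?thesis by blast
  qed
  from that [OF R1 r(2) fin] show ?thesis .
qed

text \<open>The functional equation telescoped in multiplicative form, so that no branch of
  \<open>ln Gamma\<close> has to be chosen.\<close>

lemma Gamma_shift_defect:
  assumes "\<And>j. j < N \<Longrightarrow> z + of_nat j + of_real a \<notin> \<real>\<^sub>\<le>\<^sub>0"
  shows "Gamma (z + of_real a) * exp (- ln_Gamma_approx a n z) =
     Gamma (z + of_nat N + of_real a) * exp (- ln_Gamma_approx a n (z + of_nat N))
       * exp (\<Sum>j<N. ln_Gamma_defect a n (z + of_nat j))"
  using assms
proof (induction N)
  case (Suc N)
  define u where "u = z + of_nat N"
  have u: "u + of_real a \<notin> \<real>\<^sub>\<le>\<^sub>0" using Suc.prems [of N] by (simp add: u_def)
  hence nz: "u + of_real a \<noteq> 0" by auto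
  have "u + of_real a \<notin> \<int>\<^sub>\<le>\<^sub>0" using u nonpos_Ints_subset_nonpos_Reals by blast
  hence G: "Gamma (u + 1 + of_real a) = (u + of_real a) * Gamma (u + of_real a)"
    using Gamma_plus1 [of "u + of_real a"] by (simp add: add_ac)
  have "Gamma (u + of_real a) * exp (- ln_Gamma_approx a n u) =
      Gamma (u + 1 + of_real a) * exp (- ln_Gamma_approx a n (u + 1)) * exp (ln_Gamma_defect a n u)"
    unfolding G using nz by (simp add: ln_Gamma_defect_def exp_diff exp_minus divide_simps)
  thus ?case using Suc by (simp add: u_def exp_add add_ac mult_ac)
qed auto

section \<open>The multiplicative constant in Stirling's formula\<close>

text \<open>Gauss's limit for Gamma, with the Pochhammer symbol written as a quotient of Gamma
  values. It reduces the behaviour of Gamma along \<open>z + N\<close> to that of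
  factorials.\<close>

lemma tendsto_Gamma_ratio:
  fixes z :: complex
  assumes "z \<notin> \<int>\<^sub>\<le>\<^sub>0"
  shows "(\<lambda>N. Gamma (z + of_nat N) / (fact (N - 1) * exp (z * of_real (ln (real N))))) \<longlonglongrightarrow> 1"
proof -
  have nz: "Gamma z \<noteq> 0" using assms by (simp add: Gamma_eq_zero_iff)
  have "(\<lambda>N. Gamma z / Gamma_series' z N) \<longlonglongrightarrow> Gamma z / Gamma z"
    using nz by (intro tendsto_intros Gamma_series'_LIMSEQ)
  also have "(\<lambda>N. Gamma z / Gamma_series' z N) =
      (\<lambda>N. Gamma (z + of_nat N) / (fact (N - 1) * exp (z * of_real (ln (real N)))))"
    using nz by (simp add: Gamma_series'_def pochhammer_Gamma [OF assms])
  finally show ?thesis using nz by simp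
qed

lemma tendsto_of_nat_mult_Ln_one_plus:
  "(\<lambda>N. of_nat N * Ln (1 + z / of_nat N)) \<longlonglongrightarrow> z"
proof -
  have "((\<lambda>w. Ln (1 + z * w)) has_field_derivative z) (at 0)"
    by (auto intro!: derivative_eq_intros)
  hence "((\<lambda>w. Ln (1 + z * w) / w) \<longlongrightarrow> z) (at 0)"
    by (simp add: has_field_derivative_iff)
  moreover have "filterlim (\<lambda>N. 1 / of_nat N :: complex) (at 0) sequentially"
    using lim_1_over_n [where ?'a = complex]
    by (auto simp: filterlim_at intro: eventually_mono [OF eventually_gt_at_top [of 0]])
  ultimately have "(\<lambda>N. Ln (1 + z * (1 / of_nat N)) / (1 / of_nat N)) \<longlonglongrightarrow> z"
    by (rule filterlim_compose)
  thus ?thesis by (simp add: mult.commute)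
qed

lemma tendsto_Ln_one_plus_over_n: "(\<lambda>N. Ln (1 + z / of_nat N)) \<longlonglongrightarrow> 0"
proof -
  have "(\<lambda>N. 1 / of_nat N * (of_nat N * Ln (1 + z / of_nat N))) \<longlonglongrightarrow> 0 * z"
    by (intro tendsto_mult tendsto_of_nat_mult_Ln_one_plus lim_1_over_n)
  hence "(\<lambda>N. 1 / of_nat N * (of_nat N * Ln (1 + z / of_nat N))) \<longlonglongrightarrow> 0" by simp
  thus ?thesis
    by (rule Lim_transform_eventually)
       (auto intro: eventually_mono [OF eventually_gt_at_top [of 0]])
qed

text \<open>The subtracted term is the logarithm of Stirling's main term for \<open>(N - 1)!\<close>
  plus that of \<open>N powr (z + a)\<close>. Next to \<open>tendsto_Gamma_ratio\<close> only
  Stirling's formula for factorials is then missing.\<close>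

lemma ln_Gamma_approx_shift_asymp:
  "(\<lambda>N. ln_Gamma_approx a n (z + of_nat N) -
     (of_real ((real N - 1 / 2) * ln (real N) - real N + ln (2 * pi) / 2) + (z + of_real a) * of_real (ln (real N)))) \<longlonglongrightarrow> 0"
proof -
  define g where "g = (\<lambda>N. of_nat N * Ln (1 + z / of_nat N) + (z + of_real a - 1 / 2) * Ln (1 + z / of_nat N) - z
       + (\<Sum>k=1..n. of_real (stirling_coeff a k) * (1 / (z + of_nat N)) ^ k))"
  have inv: "(\<lambda>N. 1 / (z + of_nat N)) \<longlonglongrightarrow> 0"
    by (intro tendsto_divide_0 [OF tendsto_const] tendsto_add_filterlim_at_infinity [OF tendsto_const] tendsto_of_nat)
  have "(\<lambda>N. of_real (stirling_coeff a k) * (1 / (z + of_nat N)) ^ k) \<longlonglongrightarrow> 0" if "k \<in> {1..n}" for k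
    using tendsto_mult [OF tendsto_const [of "complex_of_real (stirling_coeff a k)"] tendsto_power [OF inv, of k]] that
    by (simp add: power_0_left)
  hence "g \<longlonglongrightarrow> z + (z + of_real a - 1 / 2) * 0 - z + (\<Sum>k=1..n. 0)"
    unfolding g_def
    by (intro tendsto_add tendsto_diff tendsto_mult tendsto_const tendsto_sum tendsto_of_nat_mult_Ln_one_plus
       tendsto_Ln_one_plus_over_n)
  hence "g \<longlonglongrightarrow> 0" by simp
  moreover have "eventually (\<lambda>N. g N = ln_Gamma_approx a n (z + of_nat N) -
     (of_real ((real N - 1 / 2) * ln (real N) - real N + ln (2 * pi) / 2) + (z + of_real a) * of_real (ln (real N)))) sequentially"
    using eventually_gt_at_top [of "nat \<lceil>norm z\<rceil> + 1"]
  proof eventually_elim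
    case (elim N)
    hence N: "real N > norm z" "N > 0" by linarith+
    have "Ln (z + of_nat N) = of_real (ln (real N)) + Ln (1 + z / of_nat N)"
    proof -
      have "1 + z / of_nat N \<noteq> 0"
      proof
        assume "1 + z / of_nat N = 0"
        hence "z = - of_nat N" using N by (simp add: field_simps add_eq_0_iff2)
        thus False using N by simp
      qed
      hence "Ln (of_real (real N) * (1 + z / of_nat N)) = ln (real N) + Ln (1 + z / of_nat N)"
        using N by (subst Ln_times_of_real) auto
      moreover have "of_real (real N) * (1 + z / of_nat N) = z + of_nat N"
        using N by (simp add: field_simps)
      ultimately show ?thesis by simp
    qed
    thus ?case
      by (simp add: g_def ln_Gamma_approx_def algebra_simps power_divide)
  qed
  ultimately show ?thesis by (rule Lim_transform_eventually)
qed

lemma summable_ln_Gamma_defect_nat: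
  "summable (\<lambda>j. ln_Gamma_defect 0 0 (of_nat j))"
proof -
  obtain r C where *: "r \<ge> 1" "C \<ge> 0" "\<And>z. norm z \<ge> r \<Longrightarrow> z \<notin> \<real>\<^sub>\<le>\<^sub>0 \<Longrightarrow>
     z + of_real 0 \<notin> \<real>\<^sub>\<le>\<^sub>0 \<and> norm (ln_Gamma_defect 0 0 z) \<le> C / norm z ^ (0 + 2)"
    by (rule ln_Gamma_defect_bound [of 0 0]) blast
  show ?thesis
  proof (rule summable_comparison_test_ev)
    show "summable (\<lambda>j. C * inverse (real j ^ 2))"
      by (intro summable_mult inverse_power_summable) auto
    show "\<forall>\<^sub>F j in sequentially. norm (ln_Gamma_defect 0 0 (of_nat j)) \<le> C * inverse (real j ^ 2)"
      using eventually_gt_at_top [of "nat \<lceil>r\<rceil> + 1"]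
    proof eventually_elim
      case (elim j)
      hence "real j \<ge> r" "j > 0" by linarith+
      thus ?case using *(3) [of "of_nat j"] by (simp add: divide_inverse power2_eq_square complex_nonpos_Reals_iff)
    qed
  qed
qed

text \<open>Summability of the defects over the positive integers makes the quotient u converge to
  some nonzero l. Legendre's duplication formula gives \<open>u N ^ 2 * v N = u (2 * N)\<close> with
  v tending to 1, hence \<open>l ^ 2 = l\<close>. This is the place where the constant
  \<open>ln (2 * pi) / 2\<close> is justified.\<close>

lemma stirling_fact:
  "(\<lambda>N. fact (N - 1) * exp (- of_real ((real N - 1 / 2) * ln (real N) - real N + ln (2 * pi) / 2)) :: complex) \<longlonglongrightarrow> 1"
proof -
  define S where "S = (\<lambda>N. (real N - 1 / 2) * ln (real N) - real N + ln (2 * pi) / 2)"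
  define u :: "nat \<Rightarrow> complex" where "u = (\<lambda>N. fact (N - 1) * exp (- of_real (S N)))"
  have S: "ln_Gamma_approx 0 0 (of_nat N) = of_real (S N)" if "N > 0" for N
    using that Ln_of_real [of "real N"] by (simp add: ln_Gamma_approx_def S_def)
  have Gam: "Gamma (of_nat N) = (fact (N - 1) :: complex)" if "N > 0" for N
    using Gamma_fact [of "N - 1", where ?'a = complex] that by (simp add: of_nat_diff)
  have u: "u N = Gamma (of_nat N) * exp (- ln_Gamma_approx 0 0 (of_nat N))" if "N > 0" for N
    using that by (simp add: u_def S Gam)
  define D where "D = (\<lambda>j. ln_Gamma_defect 0 0 (1 + of_nat j))"
  have sumD: "summable D"
    using summable_ln_Gamma_defect_nat unfolding D_def
    by (subst (asm) summable_Suc_iff [symmetric]) (simp add: add_ac)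
  have "u (Suc N) = u 1 * exp (- (\<Sum>j<N. D j))" for N
  proof -
    have "u 1 = u (Suc N) * exp (\<Sum>j<N. D j)"
      using Gamma_shift_defect [of N 1 0 0] unfolding D_def
      by (simp add: u complex_nonpos_Reals_iff add_ac)
    thus ?thesis by (simp add: exp_minus field_simps)
  qed
  hence uS: "(\<lambda>N. u (Suc N)) = (\<lambda>N. u 1 * exp (- (\<Sum>j<N. D j)))" by (rule ext)
  define l where "l = u 1 * exp (- suminf D)"
  have "(\<lambda>N. u (Suc N)) \<longlonglongrightarrow> l"
    unfolding uS l_def using summable_LIMSEQ [OF sumD] by (intro tendsto_intros)
  hence ul: "u \<longlonglongrightarrow> l" by (simp add: filterlim_sequentially_Suc)
  have l0: "l \<noteq> 0" by (simp add: l_def u_def)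
  define v :: "nat \<Rightarrow> complex" where "v = (\<lambda>N. Gamma (1 / 2 + of_nat N) / (fact (N - 1) * exp (1 / 2 * of_real (ln (real N)))))"
  have half: "(1 / 2 :: complex) \<notin> \<int>\<^sub>\<le>\<^sub>0"
    using nonpos_Ints_subset_nonpos_Reals by (auto simp: complex_nonpos_Reals_iff)
  have v: "v \<longlonglongrightarrow> 1"
    unfolding v_def by (rule tendsto_Gamma_ratio [OF half])
  have dup: "u N ^ 2 * v N = u (2 * N)" if N: "N > 0" for N
  proof -
    have np: "of_nat N \<notin> (\<int>\<^sub>\<le>\<^sub>0 :: complex set)" "of_nat N + 1 / 2 \<notin> (\<int>\<^sub>\<le>\<^sub>0 :: complex set)"
      using nonpos_Ints_subset_nonpos_Reals N by (auto simp: complex_nonpos_Reals_iff)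
    have "exp (ln pi / 2) = sqrt pi" by (simp flip: ln_sqrt)
    hence sqrtpi: "exp (complex_of_real (ln pi) / 2) = complex_of_real (sqrt pi)"
      by (metis exp_of_real of_real_divide of_real_numeral)
    have "Gamma (of_nat N) * Gamma (of_nat N + 1 / 2) =
      exp ((1 - 2 * of_nat N) * of_real (ln 2)) * of_real (sqrt pi) * Gamma (2 * of_nat N :: complex)"
      using np by (rule Gamma_legendre_duplication)
    hence *: "fact (N - 1) * Gamma (1 / 2 + of_nat N) =
       (exp (of_real ((1 - 2 * real N) * ln 2)) * exp (of_real (ln pi / 2)) * fact (2 * N - 1) :: complex)"
      using N Gam [of N] Gam [of "2 * N"]
      by (simp add: add_ac sqrtpi)
    have "u N ^ 2 * v N = exp (of_real (- 2 * S N - 1 / 2 * ln (real N) + (1 - 2 * real N) * ln 2 + ln pi / 2)) * fact (2 * N - 1)"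
    proof -
      have "u N ^ 2 * v N = exp (- of_real (S N)) * exp (- of_real (S N)) * exp (- (1 / 2 * of_real (ln (real N)))) *
          (fact (N - 1) * Gamma (1 / 2 + of_nat N))"
        by (simp add: u_def v_def power2_eq_square exp_minus divide_simps)
      also note *
      also have "exp (- of_real (S N)) * exp (- of_real (S N)) * exp (- (1 / 2 * of_real (ln (real N)))) *
         (exp (of_real ((1 - 2 * real N) * ln 2)) * exp (of_real (ln pi / 2)) * fact (2 * N - 1)) =
         exp (- of_real (S N) - of_real (S N) - 1 / 2 * of_real (ln (real N)) + of_real ((1 - 2 * real N) * ln 2)
           + of_real (ln pi / 2)) * (fact (2 * N - 1) :: complex)"
        by (simp only: exp_add exp_diff exp_minus divide_inverse mult_ac)
      finally show ?thesis by simp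
    qed
    also have "- 2 * S N - 1 / 2 * ln (real N) + (1 - 2 * real N) * ln 2 + ln pi / 2 = - S (2 * N)"
      using N by (simp add: S_def ln_mult field_simps)
    finally show ?thesis by (simp add: u_def mult.commute)
  qed
  have "(\<lambda>N. u (2 * N)) \<longlonglongrightarrow> l"
    using ul by (rule filterlim_compose) (rule filterlim_subseq, simp add: strict_mono_def)
  moreover have "(\<lambda>N. u N ^ 2 * v N) \<longlonglongrightarrow> l ^ 2 * 1"
    by (intro tendsto_intros ul v)
  hence "(\<lambda>N. u (2 * N)) \<longlonglongrightarrow> l ^ 2 * 1"
    by (rule Lim_transform_eventually) (auto intro: eventually_mono [OF eventually_gt_at_top [of 0]] dup)
  ultimately have "l = l ^ 2 * 1" by (rule LIMSEQ_unique)
  hence "l = 1" using l0 by (simp add: power2_eq_square)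
  thus ?thesis using ul by (simp add: u_def S_def)
qed

lemma Gamma_approx_shift_tendsto:
  assumes "z + of_real a \<notin> \<int>\<^sub>\<le>\<^sub>0"
  shows "(\<lambda>N. Gamma (z + of_nat N + of_real a) * exp (- ln_Gamma_approx a n (z + of_nat N))) \<longlonglongrightarrow> 1"
proof -
  define S where "S = (\<lambda>N. complex_of_real ((real N - 1 / 2) * ln (real N) - real N + ln (2 * pi) / 2))"
  define L where "L = (\<lambda>N. complex_of_real (ln (real N)))"
  have "(\<lambda>N. Gamma (z + of_real a + of_nat N) / (fact (N - 1) * exp ((z + of_real a) * L N)) *
        (fact (N - 1) * exp (- S N)) *
        exp (- (ln_Gamma_approx a n (z + of_nat N) - (S N + (z + of_real a) * L N)))) \<longlonglongrightarrow> 1 * 1 * exp (- 0)"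
    unfolding S_def L_def
    by (intro tendsto_mult tendsto_exp tendsto_minus ln_Gamma_approx_shift_asymp stirling_fact
          tendsto_Gamma_ratio assms)
  thus ?thesis
    by (simp add: exp_add exp_diff exp_minus field_simps)
qed

section \<open>Error bounds in the sector and away from the real axis\<close>

text \<open>R is the sum of all defects, obtained by letting N tend to infinity in
  \<open>Gamma_shift_defect\<close>. The majorant e stays abstract because sector and strip
  telescope differently, by \<open>1 / t\<close> and by \<open>arctan\<close>.\<close>

lemma Gamma_eq_exp_approx:
  assumes "\<And>j. z + of_nat j + of_real a \<notin> \<real>\<^sub>\<le>\<^sub>0"
    and bd: "\<And>j. norm (ln_Gamma_defect a n (z + of_nat j)) \<le> e j"
    and sum: "\<And>N. (\<Sum>j<N. e j) \<le> M"
  shows "\<exists>R. norm R \<le> M \<and> Gamma (z + of_real a) = exp (ln_Gamma_approx a n z + R)"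
proof -
  define D where "D = (\<lambda>j. ln_Gamma_defect a n (z + of_nat j))"
  have e0: "0 \<le> e j" for j using bd [of j] norm_ge_zero order_trans by blast
  have sume: "summable e"
    using sum by (intro summableI_nonneg_bounded [of e M] e0)
  have sumD: "summable D"
    by (rule summable_comparison_test' [OF sume, of 0]) (use bd in \<open>auto simp: D_def\<close>)
  have "z + of_real a \<notin> \<real>\<^sub>\<le>\<^sub>0" using assms(1) [of 0] by simp
  hence np: "z + of_real a \<notin> \<int>\<^sub>\<le>\<^sub>0" using nonpos_Ints_subset_nonpos_Reals by blast
  have "(\<lambda>N. Gamma (z + of_nat N + of_real a) * exp (- ln_Gamma_approx a n (z + of_nat N))
       * exp (\<Sum>j<N. D j)) \<longlonglongrightarrow> 1 * exp (suminf D)"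
    by (intro tendsto_mult tendsto_exp Gamma_approx_shift_tendsto np summable_LIMSEQ sumD)
  also have "(\<lambda>N. Gamma (z + of_nat N + of_real a) * exp (- ln_Gamma_approx a n (z + of_nat N))
       * exp (\<Sum>j<N. D j)) = (\<lambda>N. Gamma (z + of_real a) * exp (- ln_Gamma_approx a n z))"
    unfolding D_def by (intro ext Gamma_shift_defect [symmetric] assms)
  finally have "Gamma (z + of_real a) * exp (- ln_Gamma_approx a n z) = exp (suminf D)"
    by (simp add: LIMSEQ_const_iff)
  hence "Gamma (z + of_real a) = exp (ln_Gamma_approx a n z + suminf D)"
    by (simp add: exp_add exp_minus field_simps)
  moreover have "norm (suminf D) \<le> M"
  proof -
    have "norm (suminf D) \<le> suminf e"
      using bd sume by (intro norm_suminf_le) (auto simp: D_def)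
    also have "\<dots> \<le> M" using sume sum by (rule suminf_le_const)
    finally show ?thesis .
  qed
  ultimately show ?thesis by blast
qed

text \<open>A reverse triangle inequality: in this sector adding j cannot cancel z. Each of
  \<open>norm z\<close> and j is at most twice \<open>norm (z + j)\<close>, since a negative real
  part is dominated by the imaginary part, which the shift preserves.\<close>

lemma norm_add_of_nat_sector:
  assumes "Re z \<ge> - \<bar>Im z\<bar>"
  shows "norm z + real j \<le> 4 * norm (z + of_nat j)"
proof -
  have "\<bar>Re (z + of_nat j)\<bar> \<le> norm (z + of_nat j)" "\<bar>Im (z + of_nat j)\<bar> \<le> norm (z + of_nat j)"
    by (rule abs_Re_le_cmod abs_Im_le_cmod)+
  hence "Re z + real j \<le> norm (z + of_nat j)" "\<bar>Im z\<bar> \<le> norm (z + of_nat j)" by auto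
  thus ?thesis using assms cmod_le [of z] by linarith
qed

text \<open>Of the \<open>n + 2\<close> powers in the defect bound, n are kept as
  \<open>norm z ^ n\<close>; the other two are summed by telescoping and yield one further power of
  \<open>1 / norm z\<close>.\<close>

lemma Gamma_stirling_sector:
  obtains r C where "r \<ge> 1" "C \<ge> 0"
    "\<And>z. norm z \<ge> r \<Longrightarrow> Re z \<ge> - \<bar>Im z\<bar> \<Longrightarrow>
        \<exists>R. norm R \<le> C / norm z ^ (n + 1) \<and> Gamma (z + of_real a) = exp (ln_Gamma_approx a n z + R)"
proof -
  obtain r0 C0 where r0: "r0 \<ge> 1" "C0 \<ge> 0" and bd: "\<And>z. norm z \<ge> r0 \<Longrightarrow> z \<notin> \<real>\<^sub>\<le>\<^sub>0 \<Longrightarrow>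
     z + of_real a \<notin> \<real>\<^sub>\<le>\<^sub>0 \<and> norm (ln_Gamma_defect a n z) \<le> C0 / norm z ^ (n + 2)"
    by (rule ln_Gamma_defect_bound [of a n]) blast
  \<comment> \<open>By \<open>norm_add_of_nat_sector\<close> the radius \<open>4 * r0\<close> keeps
    all shifts outside the disc of radius \<open>r0\<close>. In the constant,
    \<open>4 ^ (n + 2)\<close> comes from the same lemma and 2 from
    \<open>1 / t ^ 2 \<le> 2 * (1 / t - 1 / (t + 1))\<close> for \<open>t \<ge> 1\<close>.\<close>
  have "\<exists>R. norm R \<le> (2 * C0 * 4 ^ (n + 2)) / norm z ^ (n + 1) \<and> Gamma (z + of_real a) = exp (ln_Gamma_approx a n z + R)"
    if z: "norm z \<ge> 4 * r0" "Re z \<ge> - \<bar>Im z\<bar>" for z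
  proof (rule Gamma_eq_exp_approx)
    fix j
    have zpos: "norm z > 0" using z r0 by linarith
    have sec: "norm z + real j \<le> 4 * norm (z + of_nat j)"
      by (rule norm_add_of_nat_sector [OF z(2)])
    hence big: "norm (z + of_nat j) \<ge> r0" using z by linarith
    have pos: "0 < norm z + real j" "0 < norm (z + of_nat j)" using zpos sec big r0 by linarith+
    have "z + of_nat j \<notin> \<real>\<^sub>\<le>\<^sub>0"
    proof
      assume "z + of_nat j \<in> \<real>\<^sub>\<le>\<^sub>0"
      hence "Im z = 0" "Re z + real j \<le> 0" by (auto simp: complex_nonpos_Reals_iff)
      hence "z = 0" using z by (auto simp: complex_eq_iff)
      thus False using zpos by simp
    qed
    note b = bd [OF big this]
    thus "z + of_nat j + of_real a \<notin> \<real>\<^sub>\<le>\<^sub>0" by blast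
    have "C0 / norm (z + of_nat j) ^ (n + 2) \<le> C0 / ((norm z + real j) / 4) ^ (n + 2)"
      using sec pos r0 by (intro divide_left_mono power_mono mult_pos_pos zero_less_power) auto
    also have "\<dots> = C0 * 4 ^ (n + 2) / (norm z + real j) ^ (n + 2)"
      by (simp add: power_divide)
    also have "\<dots> \<le> C0 * 4 ^ (n + 2) / (norm z ^ n * ((norm z + real j) * (norm z + real j)))"
    proof (rule divide_left_mono)
      have "norm z ^ n * ((norm z + real j) * (norm z + real j)) \<le>
         (norm z + real j) ^ n * ((norm z + real j) * (norm z + real j))"
        by (intro mult_right_mono power_mono) auto
      thus "norm z ^ n * ((norm z + real j) * (norm z + real j)) \<le> (norm z + real j) ^ (n + 2)"
        by (simp add: mult_ac)
    qed (use zpos pos r0 in \<open>auto intro!: mult_pos_pos\<close>)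
    also have "\<dots> = C0 * 4 ^ (n + 2) / norm z ^ n * (1 / ((norm z + real j) * (norm z + real j)))"
      by simp
    also have "\<dots> \<le> C0 * 4 ^ (n + 2) / norm z ^ n * (2 * (1 / (norm z + real j) - 1 / (norm z + real (Suc j))))"
    proof (rule mult_left_mono)
      define t where "t = norm z + real j"
      have t: "t \<ge> 1" using z r0 by (simp add: t_def)
      have "t * (t + 1) \<le> 2 * (t * t)"
        using mult_left_mono [of 1 t t] t by (simp add: algebra_simps)
      hence "2 / (2 * (t * t)) \<le> 2 / (t * (t + 1))"
        using t by (intro divide_left_mono mult_pos_pos) auto
      hence "1 / (t * t) \<le> 2 / (t * (t + 1))" by simp
      also have "\<dots> = 2 * (1 / t - 1 / (t + 1))" using t by (simp add: field_simps)
      finally show "1 / ((norm z + real j) * (norm z + real j)) \<le> 2 * (1 / (norm z + real j) - 1 / (norm z + real (Suc j)))"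
        by (simp add: t_def add_ac)
    qed (use r0 in auto)
    also have "\<dots> = 2 * C0 * 4 ^ (n + 2) / norm z ^ n * (1 / (norm z + real j) - 1 / (norm z + real (Suc j)))"
      by (simp only: times_divide_eq_left times_divide_eq_right mult_ac)
    finally show "norm (ln_Gamma_defect a n (z + of_nat j)) \<le>
        2 * C0 * 4 ^ (n + 2) / norm z ^ n * (1 / (norm z + real j) - 1 / (norm z + real (Suc j)))"
      by (rule order_trans [OF conjunct2 [OF b]])
  next
    fix N
    have zpos: "norm z > 0" using z r0 by linarith
    have "(\<Sum>j<N. 2 * C0 * 4 ^ (n + 2) / norm z ^ n * (1 / (norm z + real j) - 1 / (norm z + real (Suc j)))) =
       2 * C0 * 4 ^ (n + 2) / norm z ^ n * (1 / norm z - 1 / (norm z + real N))"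
      by (subst sum_distrib_left [symmetric], subst sum_lessThan_telescope') simp
    also have "\<dots> \<le> 2 * C0 * 4 ^ (n + 2) / norm z ^ n * (1 / norm z)"
      using r0 by (intro mult_left_mono) auto
    finally show "(\<Sum>j<N. 2 * C0 * 4 ^ (n + 2) / norm z ^ n * (1 / (norm z + real j) - 1 / (norm z + real (Suc j))))
       \<le> 2 * C0 * 4 ^ (n + 2) / norm z ^ (n + 1)" by (simp add: mult_ac)
  qed
  thus ?thesis using r0 by (intro that [of "4 * r0" "2 * C0 * 4 ^ (n + 2)"]) auto
qed

text \<open>A telescoping majorant on the whole real line with finite total. It is needed because,
  for z far to the left, the shifts \<open>z + j\<close> pass above or below the origin, where
  differences of \<open>1 / t\<close> are of no use. By the mean value theorem the increment is
  \<open>1 / (1 + x ^ 2)\<close> with x between u and \<open>u + 1\<close>.\<close>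

lemma inverse_quadratic_le_arctan_diff:
  assumes "d > 0"
  shows "1 / (u\<^sup>2 + d\<^sup>2) \<le> (2 + 3 / d\<^sup>2) * (arctan (u + 1) - arctan u)"
proof -
  obtain x where x: "x > u" "x < u + 1" "arctan (u + 1) - arctan u = (u + 1 - u) * inverse (1 + x\<^sup>2)"
    using MVT2 [of u "u + 1" arctan "\<lambda>x. inverse (1 + x\<^sup>2)"] by (auto intro: DERIV_arctan)
  have "\<bar>x\<bar> \<le> \<bar>u\<bar> + 1" using x by auto
  hence "x\<^sup>2 \<le> (\<bar>u\<bar> + 1)\<^sup>2" by (metis abs_ge_zero power2_abs power_mono)
  also have "\<dots> \<le> 2 * u\<^sup>2 + 2"
    using zero_le_power2 [of "\<bar>u\<bar> - 1"] by (simp add: power2_sum power2_diff)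
  finally have "1 + x\<^sup>2 \<le> 3 + 2 * u\<^sup>2" by simp
  also have "\<dots> \<le> (2 + 3 / d\<^sup>2) * (u\<^sup>2 + d\<^sup>2)"
  proof -
    have "(2 + 3 / d\<^sup>2) * (u\<^sup>2 + d\<^sup>2) = 2 * u\<^sup>2 + 2 * d\<^sup>2 + 3 * u\<^sup>2 / d\<^sup>2 + 3"
      using assms by (simp add: field_simps)
    moreover have "3 * u\<^sup>2 / d\<^sup>2 \<ge> 0" by simp
    ultimately show ?thesis using zero_le_power2 [of d] by linarith
  qed
  finally have "1 + x\<^sup>2 \<le> (2 + 3 / d\<^sup>2) * (u\<^sup>2 + d\<^sup>2)" .
  moreover have "0 < 1 + x\<^sup>2" by (simp add: add_pos_nonneg)
  moreover have "0 < u\<^sup>2 + d\<^sup>2" using assms by (simp add: add_nonneg_pos)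
  ultimately have "1 / (u\<^sup>2 + d\<^sup>2) \<le> (2 + 3 / d\<^sup>2) * (1 / (1 + x\<^sup>2))"
    by (simp add: divide_simps mult.commute)
  thus ?thesis using x by (simp add: inverse_eq_divide)
qed

text \<open>Order 0 is enough: however large z is, some shifts may come close to the imaginary axis,
  and their share in the majorant does not shrink as z moves to the left. The sum of the defects is
  therefore only bounded.\<close>

lemma Gamma_stirling_strip:
  assumes d: "d > 0"
  obtains C where "C \<ge> 0"
    "\<And>z. \<bar>Im z\<bar> \<ge> d \<Longrightarrow> \<exists>R. norm R \<le> C \<and> Gamma (z + of_real a) = exp (ln_Gamma_approx a 0 z + R)"
proof -
  obtain r0 C0 where r0: "r0 \<ge> 1" "C0 \<ge> 0" and bd: "\<And>z. norm z \<ge> r0 \<Longrightarrow> z \<notin> \<real>\<^sub>\<le>\<^sub>0 \<Longrightarrow>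
     z + of_real a \<notin> \<real>\<^sub>\<le>\<^sub>0 \<and> norm (ln_Gamma_defect a 0 z) \<le> C0 / norm z ^ (0 + 2)"
    by (rule ln_Gamma_defect_bound [of a 0]) blast
  have nr: "z \<notin> \<real>\<^sub>\<le>\<^sub>0" if "\<bar>Im z\<bar> \<ge> d" for z
    using that d by (auto simp: complex_nonpos_Reals_iff)
  \<comment> \<open>Shifts may enter the disc of radius \<open>r0\<close>, which
    \<open>ln_Gamma_defect_bound\<close> does not cover. Away from the real axis the defect is
    continuous, so compactness bounds it there.\<close>
  define X where "X = {z. \<bar>Im z\<bar> \<ge> d} \<inter> cball 0 r0"
  have "compact X" unfolding X_def
    by (intro closed_Int_compact closed_Collect_le continuous_intros compact_cball)
  moreover have "continuous_on X (ln_Gamma_defect a 0)"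
    unfolding ln_Gamma_defect_def ln_Gamma_approx_def using nr
    by (intro continuous_intros) (auto simp: X_def)
  ultimately have "bounded (ln_Gamma_defect a 0 ` X)"
    by (intro compact_imp_bounded compact_continuous_image)
  then obtain K1 where K1: "K1 > 0" "\<And>z. z \<in> X \<Longrightarrow> norm (ln_Gamma_defect a 0 z) \<le> K1"
    unfolding bounded_pos by auto
  \<comment> \<open>The summand \<open>K1 * r0\<^sup>2\<close> gives the bound inside the disc the
    same shape \<open>1 / (norm z)\<^sup>2\<close> as the one outside.\<close>
  define C1 where "C1 = C0 + K1 * r0\<^sup>2"
  have C1: "C1 \<ge> 0" using r0 K1 by (simp add: C1_def)
  have bd1: "norm (ln_Gamma_defect a 0 z) \<le> C1 / (norm z)\<^sup>2" if "\<bar>Im z\<bar> \<ge> d" for z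
  proof (cases "norm z \<le> r0")
    case True
    have "norm z > 0" using that d by auto
    hence "K1 * (norm z)\<^sup>2 \<le> K1 * r0\<^sup>2" using True K1 by (intro mult_left_mono power_mono) auto
    moreover have "norm (ln_Gamma_defect a 0 z) * (norm z)\<^sup>2 \<le> K1 * (norm z)\<^sup>2"
      using K1(2) [of z] True that by (intro mult_right_mono) (auto simp: X_def)
    ultimately have "norm (ln_Gamma_defect a 0 z) * (norm z)\<^sup>2 \<le> C1" using r0 by (simp add: C1_def)
    thus ?thesis using \<open>norm z > 0\<close> by (simp add: field_simps)
  next
    case False
    have "norm (ln_Gamma_defect a 0 z) \<le> C0 / (norm z)\<^sup>2"
      using bd [of z] False nr [OF that] by (simp add: power2_eq_square)
    also have "\<dots> \<le> C1 / (norm z)\<^sup>2" using K1 by (intro divide_right_mono) (auto simp: C1_def)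
    finally show ?thesis .
  qed
  define K where "K = C1 * (2 + 3 / d\<^sup>2)"
  have K: "K \<ge> 0" using C1 by (simp add: K_def)
  have "\<exists>R. norm R \<le> K * pi \<and> Gamma (z + of_real a) = exp (ln_Gamma_approx a 0 z + R)"
    if z: "\<bar>Im z\<bar> \<ge> d" for z
  proof (rule Gamma_eq_exp_approx)
    fix j
    show "z + of_nat j + of_real a \<notin> \<real>\<^sub>\<le>\<^sub>0" using z by (intro nr) simp
    have "norm (ln_Gamma_defect a 0 (z + of_nat j)) \<le> C1 / (norm (z + of_nat j))\<^sup>2"
      using z by (intro bd1) simp
    also have "\<dots> \<le> C1 / ((Re z + real j)\<^sup>2 + d\<^sup>2)"
    proof (rule divide_left_mono)
      have "d\<^sup>2 \<le> (Im z)\<^sup>2" using z d by (metis abs_le_square_iff abs_of_pos)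
      thus "(Re z + real j)\<^sup>2 + d\<^sup>2 \<le> (norm (z + of_nat j))\<^sup>2" by (simp add: cmod_power2)
      have "z + of_nat j \<noteq> 0" using z d by (auto simp: complex_eq_iff)
      thus "0 < (norm (z + of_nat j))\<^sup>2 * ((Re z + real j)\<^sup>2 + d\<^sup>2)"
        using d by (intro mult_pos_pos add_nonneg_pos) auto
    qed (rule C1)
    also have "\<dots> = C1 * (1 / ((Re z + real j)\<^sup>2 + d\<^sup>2))" by simp
    also have "\<dots> \<le> C1 * ((2 + 3 / d\<^sup>2) * (arctan (Re z + real j + 1) - arctan (Re z + real j)))"
      by (intro mult_left_mono inverse_quadratic_le_arctan_diff d C1)
    finally show "norm (ln_Gamma_defect a 0 (z + of_nat j)) \<le>
        K * (arctan (Re z + real (Suc j)) - arctan (Re z + real j))"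
      by (simp add: K_def add_ac)
  next
    fix N
    have "(\<Sum>j<N. K * (arctan (Re z + real (Suc j)) - arctan (Re z + real j))) =
       K * (arctan (Re z + real N) - arctan (Re z))"
      by (subst sum_distrib_left [symmetric], subst sum_lessThan_telescope) simp
    also have "\<dots> \<le> K * pi"
      using arctan_ubound [of "Re z + real N"] arctan_lbound [of "Re z"] K by (intro mult_left_mono) auto
    finally show "(\<Sum>j<N. K * (arctan (Re z + real (Suc j)) - arctan (Re z + real j))) \<le> K * pi" .
  qed
  thus ?thesis using K by (intro that [of "K * pi"]) auto
qed

section \<open>Asymptotics of the kernel\<close>

text \<open>The terms are sorted by growth in s. After subtracting the sum for B and b, the five
  groups are governed by \<Delta>, \<open>ln \<rho>\<close>, \<open>- \<mu>\<close>,
  \<open>ln \<nu>\<close> and the numbers \<open>q_i / i\<close>.\<close>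

lemma sum_ln_Gamma_approx:
  assumes A: "\<And>k. k < p \<Longrightarrow> A k > (0::real)" and s: "s \<noteq> 0"
  shows "(\<Sum>k<p. ln_Gamma_approx (a k) n (of_real (A k) * s)) =
     of_real (\<Sum>k<p. A k) * (s * Ln s - s) + s * of_real (\<Sum>k<p. A k * ln (A k))
     + of_real ((\<Sum>k<p. a k) - real p / 2) * Ln s
     + of_real ((\<Sum>k<p. (a k - 1/2) * ln (A k)) + real p / 2 * ln (2 * pi))
     + (\<Sum>i=1..n. of_real (\<Sum>k<p. stirling_coeff (a k) i / A k ^ i) / s ^ i)"
  using A
proof (induction p)
  case (Suc p)
  have "Ln (of_real (A p) * s) = of_real (ln (A p)) + Ln s"
    using Suc.prems [of p] s by (simp add: Ln_times_of_real Ln_of_real)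
  hence "ln_Gamma_approx (a p) n (of_real (A p) * s) =
     of_real (A p) * (s * Ln s - s) + s * of_real (A p * ln (A p)) + of_real (a p - 1 / 2) * Ln s +
     of_real ((a p - 1 / 2) * ln (A p) + 1 / 2 * ln (2 * pi)) + (\<Sum>i=1..n. of_real (stirling_coeff (a p) i / A p ^ i) / s ^ i)"
    by (simp add: ln_Gamma_approx_def power_mult_distrib algebra_simps)
  moreover have "(\<Sum>i=1..n. of_real (\<Sum>k<Suc p. stirling_coeff (a k) i / A k ^ i) / s ^ i) =
      (\<Sum>i=1..n. of_real (\<Sum>k<p. stirling_coeff (a k) i / A k ^ i) / s ^ i) +
      (\<Sum>i=1..n. of_real (stirling_coeff (a p) i / A p ^ i) / s ^ i)"
    by (simp add: sum.distrib add_divide_distrib)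
  moreover have "(\<Sum>k<p. ln_Gamma_approx (a k) n (of_real (A k) * s)) =
     of_real (\<Sum>k<p. A k) * (s * Ln s - s) + s * of_real (\<Sum>k<p. A k * ln (A k))
     + of_real ((\<Sum>k<p. a k) - real p / 2) * Ln s
     + of_real ((\<Sum>k<p. (a k - 1/2) * ln (A k)) + real p / 2 * ln (2 * pi))
     + (\<Sum>i=1..n. of_real (\<Sum>k<p. stirling_coeff (a k) i / A k ^ i) / s ^ i)"
    using Suc by simp
  ultimately show ?case
    by (simp only: sum.lessThan_Suc of_real_add of_real_diff of_nat_Suc of_real_mult of_real_divide)
       (simp add: algebra_simps add_divide_distrib)
qed auto

lemma ln_H_rho:
  assumes "\<And>k. k < p \<Longrightarrow> A k > 0" "\<And>j. j < q \<Longrightarrow> B j > 0"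
  shows "H_rho p q A B > 0" "ln (H_rho p q A B) = (\<Sum>k<p. A k * ln (A k)) - (\<Sum>j<q. B j * ln (B j))"
proof -
  have pos: "(\<Prod>k<p. A k powr A k) > 0" "(\<Prod>j<q. B j powr (- B j)) > 0"
    using assms by (auto intro!: prod_pos simp: less_imp_neq [symmetric])
  thus "H_rho p q A B > 0" by (simp add: H_rho_def)
  have "ln (\<Prod>k<p. A k powr A k) = (\<Sum>k<p. A k * ln (A k))"
    using assms by (subst ln_prod) (auto intro!: sum.cong simp: ln_powr less_imp_neq [symmetric])
  moreover have "ln (\<Prod>j<q. B j powr (- B j)) = (\<Sum>j<q. - (B j * ln (B j)))"
    using assms by (subst ln_prod) (auto intro!: sum.cong simp: ln_powr less_imp_neq [symmetric])
  ultimately show "ln (H_rho p q A B) = (\<Sum>k<p. A k * ln (A k)) - (\<Sum>j<q. B j * ln (B j))"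
    using pos by (simp add: H_rho_def ln_mult_pos sum_negf del: ln_mult)
qed

lemma ln_H_nu:
  assumes "\<And>k. k < p \<Longrightarrow> A k > 0" "\<And>j. j < q \<Longrightarrow> B j > 0"
  shows "H_nu p q A a B b > 0"
    "ln (H_nu p q A a B b) = (real p - real q) / 2 * ln (2 * pi) + (\<Sum>k<p. (a k - 1/2) * ln (A k))
        - (\<Sum>j<q. (b j - 1/2) * ln (B j))"
proof -
  have pos: "(\<Prod>k<p. A k powr (a k - 1/2)) > 0" "(\<Prod>j<q. B j powr (1/2 - b j)) > 0"
    using assms by (auto intro!: prod_pos simp: less_imp_neq [symmetric])
  thus "H_nu p q A a B b > 0" by (simp add: H_nu_def)
  have "ln (\<Prod>k<p. A k powr (a k - 1/2)) = (\<Sum>k<p. (a k - 1/2) * ln (A k))"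
    using assms by (subst ln_prod) (auto intro!: sum.cong simp: ln_powr less_imp_neq [symmetric])
  moreover have "ln (\<Prod>j<q. B j powr (1/2 - b j)) = (\<Sum>j<q. - ((b j - 1/2) * ln (B j)))"
    using assms by (subst ln_prod) (auto intro!: sum.cong simp: ln_powr less_imp_neq [symmetric] algebra_simps)
  ultimately show "ln (H_nu p q A a B b) = (real p - real q) / 2 * ln (2 * pi) + (\<Sum>k<p. (a k - 1/2) * ln (A k))
        - (\<Sum>j<q. (b j - 1/2) * ln (B j))"
    unfolding H_nu_def using pos by (subst ln_mult_pos; simp add: ln_mult_pos mult_pos_pos ln_powr sum_negf)+
qed

lemma H_qcoef_conv_stirling_coeff:
  assumes "i \<ge> 1"
  shows "H_qcoef p q A a B b i / real i =
    (\<Sum>k<p. stirling_coeff (a k) i / A k ^ i) - (\<Sum>j<q. stirling_coeff (b j) i / B j ^ i)"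
proof -
  have "stirling_coeff x i / y = (-1) ^ (i + 1) / real (i + 1) / real i * (bernoulli_poly (i + 1) x / y)" for x y
    by (simp add: stirling_coeff_def)
  thus ?thesis
    by (simp only: sum_distrib_left [symmetric] H_qcoef_def right_diff_distrib [symmetric]) simp
qed

text \<open>The hypothesis \<open>\<Delta> = 0\<close> removes \<open>s * Ln s - s\<close>, and
  \<open>\<mu> = - m\<close> makes the coefficient of \<open>Ln s\<close> equal to m, so that the
  branch of the logarithm disappears in \<open>s ^ m\<close>.\<close>

lemma H_kernel_eq:
  assumes A: "\<And>k. k < p \<Longrightarrow> A k > 0" and B: "\<And>j. j < q \<Longrightarrow> B j > 0"
    and D: "(\<Sum>j<q. B j) - (\<Sum>k<p. A k) = 0" and mu: "H_mu p q a b = - real m"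
    and s: "s \<noteq> 0"
    and R: "\<And>k. k < p \<Longrightarrow> Gamma (of_real (A k) * s + of_real (a k)) =
       exp (ln_Gamma_approx (a k) n (of_real (A k) * s) + R k)"
    and R': "\<And>j. j < q \<Longrightarrow> Gamma (of_real (B j) * s + of_real (b j)) =
       exp (ln_Gamma_approx (b j) n (of_real (B j) * s) + R' j)"
  shows "H_kernel p q A a B b s =
     of_real (H_nu p q A a B b) * exp (s * of_real (ln (H_rho p q A B))) * s ^ m *
     exp ((\<Sum>i=1..n. of_real (H_qcoef p q A a B b i / real i) * (1 / s) ^ i)
         + ((\<Sum>k<p. R k) - (\<Sum>j<q. R' j)))"
proof -
  have 1: "(\<Prod>k<p. Gamma (of_real (A k) * s + of_real (a k))) =
     exp ((\<Sum>k<p. ln_Gamma_approx (a k) n (of_real (A k) * s)) + (\<Sum>k<p. R k))"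
    by (simp add: R sum.distrib [symmetric] exp_sum)
  have 2: "(\<Prod>j<q. rGamma (of_real (B j) * s + of_real (b j))) =
     exp (- ((\<Sum>j<q. ln_Gamma_approx (b j) n (of_real (B j) * s)) + (\<Sum>j<q. R' j)))"
    unfolding rGamma_inverse_Gamma exp_minus
    by (simp add: R' sum.distrib [symmetric] exp_sum prod_inversef [symmetric] o_def)
  have q: "(\<Sum>i=1..n. of_real (\<Sum>k<p. stirling_coeff (a k) i / A k ^ i) / s ^ i) -
        (\<Sum>i=1..n. of_real (\<Sum>j<q. stirling_coeff (b j) i / B j ^ i) / s ^ i) =
        (\<Sum>i=1..n. of_real (H_qcoef p q A a B b i / real i) * (1 / s) ^ i)"
  proof (subst sum_subtractf [symmetric], intro sum.cong refl, goal_cases)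
    case (1 i)
    hence "i \<ge> 1" by simp
    show ?case unfolding H_qcoef_conv_stirling_coeff [OF \<open>i \<ge> 1\<close>]
      by (simp add: power_divide diff_divide_distrib)
  qed
  have nu: "of_real (H_nu p q A a B b) = exp (complex_of_real (ln (H_nu p q A a B b)))"
    using ln_H_nu(1) [of p A q B a b, OF A B] by (simp add: exp_of_real)
  have sm: "s ^ m = exp (of_real (real m) * Ln s)"
    using s by (simp add: exp_of_nat_mult)
  have m: "real m = ((\<Sum>k<p. a k) - real p / 2) - ((\<Sum>j<q. b j) - real q / 2)"
    using mu by (simp add: H_mu_def field_simps)
  have lnu: "ln (H_nu p q A a B b) = ((\<Sum>k<p. (a k - 1/2) * ln (A k)) + real p / 2 * ln (2 * pi)) -
     ((\<Sum>j<q. (b j - 1/2) * ln (B j)) + real q / 2 * ln (2 * pi))"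
    using ln_H_nu(2) [of p A q B a b, OF A B] by (simp add: algebra_simps add_divide_distrib diff_divide_distrib)
  have lrho: "ln (H_rho p q A B) = (\<Sum>k<p. A k * ln (A k)) - (\<Sum>j<q. B j * ln (B j))"
    using ln_H_rho(2) [of p A q B, OF A B] .
  have D': "(\<Sum>j<q. B j) = (\<Sum>k<p. A k)" using D by simp
  note SA = sum_ln_Gamma_approx [of p A s a n, OF A s] and SB = sum_ln_Gamma_approx [of q B s b n, OF B s]
  have "H_kernel p q A a B b s = exp (((\<Sum>k<p. ln_Gamma_approx (a k) n (of_real (A k) * s)) + (\<Sum>k<p. R k)) +
     - ((\<Sum>j<q. ln_Gamma_approx (b j) n (of_real (B j) * s)) + (\<Sum>j<q. R' j)))"
    unfolding H_kernel_def 1 2 by (rule exp_add [symmetric])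
  also have "\<dots> = exp (of_real (ln (H_nu p q A a B b)) + s * of_real (ln (H_rho p q A B)) + of_real (real m) * Ln s
      + ((\<Sum>i=1..n. of_real (H_qcoef p q A a B b i / real i) * (1 / s) ^ i) + ((\<Sum>k<p. R k) - (\<Sum>j<q. R' j))))"
    by (rule arg_cong [where f = exp], subst SA, assumption, subst SB, assumption,
        unfold D' m lnu lrho q [symmetric] of_real_diff of_real_add)
       (simp add: algebra_simps)
  also have "\<dots> = of_real (H_nu p q A a B b) * exp (s * of_real (ln (H_rho p q A B))) * s ^ m *
     exp ((\<Sum>i=1..n. of_real (H_qcoef p q A a B b i / real i) * (1 / s) ^ i)
         + ((\<Sum>k<p. R k) - (\<Sum>j<q. R' j)))"
    unfolding nu sm by (simp only: exp_add)
  finally show ?thesis .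
qed

text \<open>The region X and the error size g are parameters because the lemma serves twice: in the
  sector with error \<open>1 / norm s ^ (n + 1)\<close>, and for
  \<open>\<bar>Im s\<bar> \<ge> 1\<close> with a constant error.\<close>

lemma H_kernel_expansion:
  fixes g :: "complex \<Rightarrow> real"
  assumes A: "\<And>k. k < p \<Longrightarrow> A k > 0" and B: "\<And>j. j < q \<Longrightarrow> B j > 0"
    and D: "(\<Sum>j<q. B j) - (\<Sum>k<p. A k) = 0" and mu: "H_mu p q a b = - real m"
    and g: "\<And>s. g s \<ge> 0"
    and approx: "\<And>c x. c > 0 \<Longrightarrow> \<exists>r C. \<forall>s. norm s \<ge> r \<and> X s \<longrightarrow>
       (\<exists>R. norm R \<le> C * g s \<and> Gamma (of_real c * s + of_real x) = exp (ln_Gamma_approx x n (of_real c * s) + R))"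
  shows "\<exists>r C. r \<ge> 1 \<and> C \<ge> 0 \<and> (\<forall>s. norm s \<ge> r \<and> X s \<longrightarrow> (\<exists>R. norm R \<le> C * g s \<and>
     H_kernel p q A a B b s =
     of_real (H_nu p q A a B b) * exp (s * of_real (ln (H_rho p q A B))) * s ^ m *
     exp ((\<Sum>i=1..n. of_real (H_qcoef p q A a B b i / real i) * (1 / s) ^ i) + R)))"
proof -
  obtain r C where rC: "\<And>c x s. c > 0 \<Longrightarrow> norm s \<ge> r c x \<Longrightarrow> X s \<Longrightarrow>
       (\<exists>R. norm R \<le> C c x * g s \<and> Gamma (of_real c * s + of_real x) = exp (ln_Gamma_approx x n (of_real c * s) + R))"
    using approx by metis
  define r' where "r' = 1 + (\<Sum>k<p. \<bar>r (A k) (a k)\<bar>) + (\<Sum>j<q. \<bar>r (B j) (b j)\<bar>)"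
  define C' where "C' = (\<Sum>k<p. \<bar>C (A k) (a k)\<bar>) + (\<Sum>j<q. \<bar>C (B j) (b j)\<bar>)"
  have rA: "r (A k) (a k) \<le> r'" if "k < p" for k
  proof -
    have "\<bar>r (A k) (a k)\<bar> \<le> (\<Sum>k<p. \<bar>r (A k) (a k)\<bar>)"
      using that by (intro member_le_sum) auto
    moreover have "(\<Sum>j<q. \<bar>r (B j) (b j)\<bar>) \<ge> 0" by (intro sum_nonneg) auto
    ultimately show ?thesis unfolding r'_def by linarith
  qed
  have rB: "r (B j) (b j) \<le> r'" if "j < q" for j
  proof -
    have "\<bar>r (B j) (b j)\<bar> \<le> (\<Sum>j<q. \<bar>r (B j) (b j)\<bar>)"
      using that by (intro member_le_sum) auto
    moreover have "(\<Sum>k<p. \<bar>r (A k) (a k)\<bar>) \<ge> 0" by (intro sum_nonneg) auto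
    ultimately show ?thesis unfolding r'_def by linarith
  qed
  have main: "\<exists>R. norm R \<le> C' * g s \<and>
     H_kernel p q A a B b s =
     of_real (H_nu p q A a B b) * exp (s * of_real (ln (H_rho p q A B))) * s ^ m *
     exp ((\<Sum>i=1..n. of_real (H_qcoef p q A a B b i / real i) * (1 / s) ^ i) + R)"
    if s: "norm s \<ge> r'" "X s" for s
  proof -
    have "r' \<ge> 1" by (auto simp: r'_def intro!: add_nonneg_nonneg sum_nonneg)
    hence s0: "s \<noteq> 0" using s by auto
    have "\<forall>k. \<exists>R. k < p \<longrightarrow> norm R \<le> C (A k) (a k) * g s \<and> Gamma (of_real (A k) * s + of_real (a k)) =
        exp (ln_Gamma_approx (a k) n (of_real (A k) * s) + R)"
      using rC [OF A] rA s by (meson order_trans)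
    then obtain R where R: "\<And>k. k < p \<Longrightarrow> norm (R k) \<le> C (A k) (a k) * g s"
       "\<And>k. k < p \<Longrightarrow> Gamma (of_real (A k) * s + of_real (a k)) =
        exp (ln_Gamma_approx (a k) n (of_real (A k) * s) + R k)" by metis
    have "\<forall>j. \<exists>R. j < q \<longrightarrow> norm R \<le> C (B j) (b j) * g s \<and> Gamma (of_real (B j) * s + of_real (b j)) =
        exp (ln_Gamma_approx (b j) n (of_real (B j) * s) + R)"
      using rC [OF B] rB s by (meson order_trans)
    then obtain R' where R': "\<And>j. j < q \<Longrightarrow> norm (R' j) \<le> C (B j) (b j) * g s"
       "\<And>j. j < q \<Longrightarrow> Gamma (of_real (B j) * s + of_real (b j)) =
        exp (ln_Gamma_approx (b j) n (of_real (B j) * s) + R' j)" by metis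
    have b1: "norm (\<Sum>k<p. R k) \<le> (\<Sum>k<p. \<bar>C (A k) (a k)\<bar> * g s)"
      using R(1) g [of s] by (intro sum_norm_le order_trans [OF R(1)] mult_right_mono) auto
    have b2: "norm (\<Sum>j<q. R' j) \<le> (\<Sum>j<q. \<bar>C (B j) (b j)\<bar> * g s)"
      using R'(1) g [of s] by (intro sum_norm_le order_trans [OF R'(1)] mult_right_mono) auto
    have "norm ((\<Sum>k<p. R k) - (\<Sum>j<q. R' j)) \<le> norm (\<Sum>k<p. R k) + norm (\<Sum>j<q. R' j)"
      by (rule norm_triangle_ineq4)
    also have "\<dots> \<le> C' * g s"
      using b1 b2 by (simp add: C'_def ring_distribs sum_distrib_right)
    finally show ?thesis
      using H_kernel_eq [OF A B D mu s0 R(2) R'(2)] by blast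
  qed
  have "r' \<ge> 1" "C' \<ge> 0"
    by (auto simp: r'_def C'_def intro!: add_nonneg_nonneg sum_nonneg)
  with main show ?thesis by blast
qed

section \<open>The numbers l_r as coefficients of an exponential\<close>

lemma H_lcoef_0: "H_lcoef p q A a B b 0 = 1"
  by (subst H_lcoef.simps) simp

lemma H_lcoef_Suc:
  "real (Suc n) * H_lcoef p q A a B b (Suc n) =
     (\<Sum>i=0..n. H_qcoef p q A a B b (Suc i) * H_lcoef p q A a B b (n - i))"
proof -
  have "real (Suc n) * H_lcoef p q A a B b (Suc n) =
     (\<Sum>i\<in>{1..Suc n}. H_qcoef p q A a B b i * H_lcoef p q A a B b (Suc n - i))"
    by (subst H_lcoef.simps) (simp del: H_lcoef.simps)
  also have "\<dots> = (\<Sum>i=0..n. H_qcoef p q A a B b (Suc i) * H_lcoef p q A a B b (n - i))"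
    using sum.shift_bounds_cl_Suc_ivl [of "\<lambda>i. H_qcoef p q A a B b i * H_lcoef p q A a B b (Suc n - i)" 0 n]
    by (simp del: H_lcoef.simps)
  finally show ?thesis .
qed

declare H_lcoef.simps [simp del]

text \<open>The recursion for l is the differential equation \<open>F' = Q' * F\<close> of
  \<open>F = exp Q\<close>, where Q has the coefficients \<open>q_i / i\<close>, read off
  coefficientwise. Cutting Q at degree m leaves F unchanged up to that degree, and R enters only at
  order \<open>m + 1\<close>.\<close>

lemma exp_series_H_lcoef_bound:
  fixes C :: real
  obtains r K where "r > 0" "K \<ge> 0"
    "\<And>w R :: complex. norm w < r \<Longrightarrow> norm R \<le> C * norm w ^ (m + 1) \<Longrightarrow>
      norm (exp ((\<Sum>i=1..m. of_real (H_qcoef p q A a B b i / real i) * w ^ i) + R)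
          - (\<Sum>i\<le>m. of_real (H_lcoef p q A a B b i) * w ^ i)) \<le> K * norm w ^ (m + 1)"
proof -
  define c where "c = (\<lambda>i. complex_of_real (H_qcoef p q A a B b i))"
  define l where "l = (\<lambda>i. complex_of_real (H_lcoef p q A a B b i))"
  define Q :: "complex fps" where "Q = (\<Sum>i=1..m. fps_const (c i / of_nat i) * fps_X ^ i)"
  define Qf where "Qf = (\<lambda>w. \<Sum>i=1..m. c i / of_nat i * w ^ i)"
  define F where "F = fps_exp 1 oo Q"
  have Qn: "fps_nth Q i = (if 1 \<le> i \<and> i \<le> m then c i / of_nat i else 0)" for i
    by (auto simp: Q_def fps_sum_nth sum.delta if_distrib cong: if_cong)
  have Q0: "fps_nth Q 0 = 0" by (simp add: Qn)
  have Qe: "Qf has_fps_expansion Q"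
    unfolding Qf_def Q_def
    by (intro has_fps_expansion_sum has_fps_expansion_mult has_fps_expansion_const has_fps_expansion_fps_X_power)
  have Fe: "(\<lambda>w. exp (Qf w)) has_fps_expansion F"
    using has_fps_expansion_compose [OF has_fps_expansion_exp1 Qe Q0] by (simp add: F_def o_def)
  have dF: "fps_deriv F = fps_deriv Q * F"
    unfolding F_def by (subst fps_compose_deriv) (simp_all add: Q0 mult.commute)
  have Fn: "fps_nth F i = l i" if "i \<le> m" for i
    using that
  proof (induction i rule: less_induct)
    case (less i)
    show ?case
    proof (cases i)
      case 0
      thus ?thesis by (simp add: F_def l_def H_lcoef_0)
    next
      case (Suc n)
      have "of_nat (Suc n) * fps_nth F (Suc n) = fps_nth (fps_deriv F) n" by simp
      also have "\<dots> = (\<Sum>i=0..n. fps_nth (fps_deriv Q) i * fps_nth F (n - i))"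
        unfolding dF by (simp add: fps_mult_nth)
      also have "\<dots> = (\<Sum>i=0..n. c (Suc i) * l (n - i))"
        using less Suc by (intro sum.cong refl arg_cong2 [where f = "(*)"]) (auto simp: Qn simp del: of_nat_Suc)
      also have "\<dots> = of_nat (Suc n) * l (Suc n)"
        unfolding l_def c_def of_real_mult [symmetric] of_real_sum [symmetric] H_lcoef_Suc [symmetric]
        by (simp del: of_nat_Suc)
      finally show ?thesis using Suc by (simp del: of_nat_Suc)
    qed
  qed
  define Pf where "Pf = (\<lambda>w. \<Sum>i\<le>m. l i * w ^ i)"
  have "(\<lambda>w. exp (Qf w) - Pf w) has_fps_expansion (F - (\<Sum>i\<le>m. fps_const (l i) * fps_X ^ i))"
    unfolding Pf_def
    by (intro has_fps_expansion_diff Fe has_fps_expansion_sum has_fps_expansion_mult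
          has_fps_expansion_const has_fps_expansion_fps_X_power)
  moreover have "fps_nth (F - (\<Sum>i\<le>m. fps_const (l i) * fps_X ^ i)) i = 0" if "i < m + 1" for i
    using that Fn [of i] by (simp add: fps_sum_nth sum.delta if_distrib cong: if_cong)
  ultimately obtain r1 C1 where 1: "r1 > 0" "C1 \<ge> 0"
    "\<And>w. norm w < r1 \<Longrightarrow> norm (exp (Qf w) - Pf w) \<le> C1 * norm w ^ (m + 1)"
    by (rule has_fps_expansion_imp_bound [where n = "m + 1"]) (use that in auto)
  have "(\<lambda>w::complex. exp w - 1) has_fps_expansion (fps_exp 1 - 1)"
    by (intro has_fps_expansion_diff has_fps_expansion_exp1 has_fps_expansion_1)
  then obtain r2 C2 where 2: "r2 > 0" "C2 \<ge> 0" "\<And>w::complex. norm w < r2 \<Longrightarrow> norm (exp w - 1) \<le> C2 * norm w ^ 1"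
    by (rule has_fps_expansion_imp_bound [where n = 1]) auto
  obtain r3 C3 where 3: "r3 > 0" "C3 \<ge> 0" "\<And>w. norm w < r3 \<Longrightarrow> norm (exp (Qf w)) \<le> C3 * norm w ^ 0"
    using Fe by (rule has_fps_expansion_imp_bound [where n = 0]) auto
  \<comment> \<open>\<open>norm w < 1\<close> reduces \<open>norm w ^ (m + 1)\<close> to
    \<open>norm w\<close>, and the last entry then keeps R within the radius \<open>r2\<close>.
    Nothing is assumed about the sign of C, hence \<open>\<bar>C\<bar> + 1\<close>.\<close>
  define r where "r = min (min r1 r3) (min 1 (r2 / (\<bar>C\<bar> + 1)))"
  define K where "K = C1 + C3 * (C2 * \<bar>C\<bar>)"
  have r: "r > 0" using 1 2 3 by (simp add: r_def)
  have K: "K \<ge> 0" using 1 2 3 by (simp add: K_def)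
  have "norm (exp (Qf w + R) - Pf w) \<le> K * norm w ^ (m + 1)"
    if w: "norm w < r" "norm R \<le> C * norm w ^ (m + 1)" for w R
  proof -
    have w': "norm w < r1" "norm w < r3" "norm w < 1" "norm w < r2 / (\<bar>C\<bar> + 1)"
      using w by (auto simp: r_def)
    have R: "norm R \<le> \<bar>C\<bar> * norm w ^ (m + 1)"
      using w(2) by (rule order_trans) (intro mult_right_mono, auto)
    also have "\<dots> \<le> \<bar>C\<bar> * norm w"
      using w'(3) power_decreasing [of 1 "m + 1" "norm w"] by (intro mult_left_mono) auto
    also have "\<dots> \<le> (\<bar>C\<bar> + 1) * norm w" by (intro mult_right_mono) auto
    also have "\<dots> < r2" using w'(4) by (simp add: field_simps)
    finally have Rr: "norm R < r2" .
    have "norm (exp R - 1) \<le> C2 * norm R" using 2(3) [OF Rr] by simp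
    also have "\<dots> \<le> C2 * (\<bar>C\<bar> * norm w ^ (m + 1))" using R 2 by (intro mult_left_mono) auto
    finally have eR: "norm (exp R - 1) \<le> C2 * (\<bar>C\<bar> * norm w ^ (m + 1))" .
    have "exp (Qf w + R) - Pf w = (exp (Qf w) - Pf w) + exp (Qf w) * (exp R - 1)"
      by (simp add: exp_add algebra_simps)
    also have "norm \<dots> \<le> norm (exp (Qf w) - Pf w) + norm (exp (Qf w)) * norm (exp R - 1)"
      by (rule order_trans [OF norm_triangle_ineq]) (simp add: norm_mult)
    also have "\<dots> \<le> C1 * norm w ^ (m + 1) + C3 * (C2 * (\<bar>C\<bar> * norm w ^ (m + 1)))"
      using 1(3) [OF w'(1)] 3(3) [OF w'(2)] eR 3(2) by (intro add_mono mult_mono) auto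
    also have "\<dots> = K * norm w ^ (m + 1)" by (simp add: K_def algebra_simps)
    finally show ?thesis .
  qed
  thus ?thesis
    using that [OF r K] by (simp add: Qf_def Pf_def c_def l_def)
qed

section \<open>Bounds and holomorphy of the remainder\<close>

lemma Gamma_scaled_sector:
  assumes c: "c > 0"
  shows "\<exists>r C. \<forall>s. norm s \<ge> r \<and> Re s \<ge> - \<bar>Im s\<bar> \<longrightarrow>
       (\<exists>R. norm R \<le> C * (1 / norm s ^ (n + 1)) \<and> Gamma (of_real c * s + of_real x) = exp (ln_Gamma_approx x n (of_real c * s) + R))"
proof -
  obtain r C where rC: "r \<ge> 1" "C \<ge> 0" "\<And>z. norm z \<ge> r \<Longrightarrow> Re z \<ge> - \<bar>Im z\<bar> \<Longrightarrow>
        \<exists>R. norm R \<le> C / norm z ^ (n + 1) \<and> Gamma (z + of_real x) = exp (ln_Gamma_approx x n z + R)"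
    by (rule Gamma_stirling_sector [of n x]) blast
  show ?thesis
  proof (rule exI [of _ "r / c"], rule exI [of _ "C / c ^ (n + 1)"], intro allI impI)
    fix s assume s: "norm s \<ge> r / c \<and> Re s \<ge> - \<bar>Im s\<bar>"
    have "norm (of_real c * s) \<ge> r" using s c by (simp add: norm_mult field_simps)
    moreover have "Re (of_real c * s) \<ge> - \<bar>Im (of_real c * s)\<bar>"
      using s c mult_left_mono [of "- \<bar>Im s\<bar>" "Re s" c] by (simp add: abs_mult)
    ultimately obtain R where R: "norm R \<le> C / norm (of_real c * s) ^ (n + 1)"
       "Gamma (of_real c * s + of_real x) = exp (ln_Gamma_approx x n (of_real c * s) + R)"
      using rC(3) by blast
    have "C / norm (of_real c * s) ^ (n + 1) = C / c ^ (n + 1) * (1 / norm s ^ (n + 1))"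
      using c by (simp only: norm_mult norm_of_real power_mult_distrib abs_of_pos) simp
    with R show "\<exists>R. norm R \<le> C / c ^ (n + 1) * (1 / norm s ^ (n + 1)) \<and>
        Gamma (of_real c * s + of_real x) = exp (ln_Gamma_approx x n (of_real c * s) + R)" by metis
  qed
qed

text \<open>Scaling maps \<open>\<bar>Im s\<bar> \<ge> 1\<close> to height c, which may be small;
  this is why \<open>Gamma_stirling_strip\<close> admits every positive height.\<close>

lemma Gamma_scaled_strip:
  assumes c: "c > 0"
  shows "\<exists>r C. \<forall>s. norm s \<ge> r \<and> \<bar>Im s\<bar> \<ge> 1 \<longrightarrow>
       (\<exists>R. norm R \<le> C * 1 \<and> Gamma (of_real c * s + of_real x) = exp (ln_Gamma_approx x 0 (of_real c * s) + R))"
proof -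
  obtain C where C: "C \<ge> 0" "\<And>z. \<bar>Im z\<bar> \<ge> c \<Longrightarrow>
        \<exists>R. norm R \<le> C \<and> Gamma (z + of_real x) = exp (ln_Gamma_approx x 0 z + R)"
    by (rule Gamma_stirling_strip [OF c, of x]) blast
  show ?thesis
  proof (rule exI [of _ 0], rule exI [of _ C], intro allI impI)
    fix s assume s: "norm s \<ge> 0 \<and> \<bar>Im s\<bar> \<ge> 1"
    have "\<bar>Im (of_real c * s)\<bar> \<ge> c" using s c by (simp add: abs_mult)
    from C(2) [OF this] show "\<exists>R. norm R \<le> C * 1 \<and> Gamma (of_real c * s + of_real x) = exp (ln_Gamma_approx x 0 (of_real c * s) + R)"
      by simp
  qed
qed

text \<open>This will turn out to be \<open>\<rho> powr (- s)\<close> times the Mellin transform of the H function.\<close>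
definition H_remainder :: "nat \<Rightarrow> nat \<Rightarrow> (nat \<Rightarrow> real) \<Rightarrow> (nat \<Rightarrow> real) \<Rightarrow> (nat \<Rightarrow> real) \<Rightarrow> (nat \<Rightarrow> real) \<Rightarrow> nat \<Rightarrow> complex \<Rightarrow> complex" where
  "H_remainder p q A a B b m s = H_kernel p q A a B b s * exp (- s * of_real (ln (H_rho p q A B)))
     - of_real (H_nu p q A a B b) * (\<Sum>k\<le>m. of_real (H_lcoef p q A a B b (m - k)) * s ^ k)"

text \<open>The expansion is taken to order m exactly: its error \<open>O(s ^ (- m - 1))\<close>
  times \<open>s ^ m\<close> is \<open>O(1 / s)\<close>. Reversing the summation index turns the
  subtracted polynomial into \<open>s ^ m\<close> times the truncated series in
  \<open>1 / s\<close>.\<close>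

lemma H_remainder_sector_bound:
  assumes A: "\<And>k. k < p \<Longrightarrow> A k > 0" and B: "\<And>j. j < q \<Longrightarrow> B j > 0"
    and D: "(\<Sum>j<q. B j) - (\<Sum>k<p. A k) = 0" and mu: "H_mu p q a b = - real m"
  shows "\<exists>r C. r \<ge> 1 \<and> C \<ge> 0 \<and>
    (\<forall>s. norm s \<ge> r \<and> Re s \<ge> - \<bar>Im s\<bar> \<longrightarrow> norm (H_remainder p q A a B b m s) \<le> C / norm s)"
proof -
  obtain r C where rC: "r \<ge> 1" "C \<ge> 0" "\<And>s. norm s \<ge> r \<and> Re s \<ge> - \<bar>Im s\<bar> \<Longrightarrow>
     (\<exists>R. norm R \<le> C * (1 / norm s ^ (m + 1)) \<and> H_kernel p q A a B b s =
     of_real (H_nu p q A a B b) * exp (s * of_real (ln (H_rho p q A B))) * s ^ m *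
     exp ((\<Sum>i=1..m. of_real (H_qcoef p q A a B b i / real i) * (1 / s) ^ i) + R))"
    using H_kernel_expansion [OF A B D mu, of "\<lambda>s. 1 / norm s ^ (m + 1)" "\<lambda>s. Re s \<ge> - \<bar>Im s\<bar>" m,
        OF _ _ _ Gamma_scaled_sector] by auto
  obtain r0 K where K: "r0 > 0" "K \<ge> 0"
    "\<And>w R :: complex. norm w < r0 \<Longrightarrow> norm R \<le> C * norm w ^ (m + 1) \<Longrightarrow>
      norm (exp ((\<Sum>i=1..m. of_real (H_qcoef p q A a B b i / real i) * w ^ i) + R)
          - (\<Sum>i\<le>m. of_real (H_lcoef p q A a B b i) * w ^ i)) \<le> K * norm w ^ (m + 1)"
    by (rule exp_series_H_lcoef_bound [of C m p q A a B b]) blast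
  define nu where "nu = H_nu p q A a B b"
  have nu: "nu > 0" unfolding nu_def using A B by (intro ln_H_nu)
  have "norm (H_remainder p q A a B b m s) \<le> nu * K / norm s"
    if s: "norm s \<ge> r + 2 / r0" "Re s \<ge> - \<bar>Im s\<bar>" for s
  proof -
    have "1 / r0 > 0" "2 / r0 = 1 / r0 + 1 / r0" using K by simp_all
    hence sr: "norm s \<ge> r" "norm s > 1 / r0" "norm s > 0" using s rC by linarith+
    hence s0: "s \<noteq> 0" by auto
    obtain R where R: "norm R \<le> C * (1 / norm s ^ (m + 1))" "H_kernel p q A a B b s =
       of_real nu * exp (s * of_real (ln (H_rho p q A B))) * s ^ m *
       exp ((\<Sum>i=1..m. of_real (H_qcoef p q A a B b i / real i) * (1 / s) ^ i) + R)"
      using rC(3) [of s] s sr unfolding nu_def by blast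
    define L where "L = (\<Sum>i\<le>m. of_real (H_lcoef p q A a B b i) * (1 / s) ^ i)"
    define X where "X = exp ((\<Sum>i=1..m. of_real (H_qcoef p q A a B b i / real i) * (1 / s) ^ i) + R)"
    have w: "norm (1 / s) < r0" using sr K by (simp add: norm_divide field_simps)
    have "norm (X - L) \<le> K * norm (1 / s) ^ (m + 1)"
      unfolding X_def L_def using R(1) by (intro K(3) w) (simp add: norm_divide power_divide)
    also have "\<dots> = K / norm s ^ (m + 1)" by (simp add: norm_divide power_divide)
    finally have XL: "norm (X - L) \<le> K / norm s ^ (m + 1)" .
    have sum: "(\<Sum>k\<le>m. of_real (H_lcoef p q A a B b (m - k)) * s ^ k) = s ^ m * L"
    proof -
      have "(\<Sum>k\<le>m. of_real (H_lcoef p q A a B b (m - k)) * s ^ k) =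
            (\<Sum>i\<le>m. of_real (H_lcoef p q A a B b i) * s ^ (m - i))"
        by (rule sum.reindex_bij_witness [of _ "\<lambda>i. m - i" "\<lambda>i. m - i"]) auto
      also have "\<dots> = (\<Sum>i\<le>m. s ^ m * (of_real (H_lcoef p q A a B b i) * (1 / s) ^ i))"
        using s0 by (intro sum.cong refl) (auto simp: power_diff power_divide)
      finally show ?thesis by (simp add: L_def sum_distrib_left)
    qed
    have "H_kernel p q A a B b s * exp (- s * of_real (ln (H_rho p q A B))) = of_real nu * s ^ m * X"
      unfolding R(2) X_def by (simp add: exp_minus)
    hence "H_remainder p q A a B b m s = of_real nu * s ^ m * (X - L)"
      unfolding H_remainder_def sum nu_def [symmetric] by (simp add: algebra_simps)
    hence "norm (H_remainder p q A a B b m s) = nu * norm s ^ m * norm (X - L)"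
      using nu by (simp add: norm_mult norm_power)
    also have "\<dots> \<le> nu * norm s ^ m * (K / norm s ^ (m + 1))"
      using nu XL by (intro mult_left_mono) auto
    also have "\<dots> = nu * K / norm s" using sr by simp
    finally show ?thesis .
  qed
  moreover have "r + 2 / r0 \<ge> 1" "nu * K \<ge> 0" using rC K nu by (simp_all add: add_increasing2)
  ultimately show ?thesis by blast
qed

text \<open>No cancellation between kernel and polynomial is used here; both are of size
  \<open>norm s ^ m\<close>. This suffices where an exponentially small factor is present.\<close>

lemma H_remainder_strip_bound:
  assumes A: "\<And>k. k < p \<Longrightarrow> A k > 0" and B: "\<And>j. j < q \<Longrightarrow> B j > 0"
    and D: "(\<Sum>j<q. B j) - (\<Sum>k<p. A k) = 0" and mu: "H_mu p q a b = - real m"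
  shows "\<exists>r C. r \<ge> 1 \<and> C \<ge> 0 \<and>
    (\<forall>s. norm s \<ge> r \<and> \<bar>Im s\<bar> \<ge> 1 \<longrightarrow> norm (H_remainder p q A a B b m s) \<le> C * norm s ^ m)"
proof -
  obtain r C where rC: "r \<ge> 1" "C \<ge> 0" "\<And>s. norm s \<ge> r \<and> \<bar>Im s\<bar> \<ge> 1 \<Longrightarrow>
     (\<exists>R. norm R \<le> C * 1 \<and> H_kernel p q A a B b s =
     of_real (H_nu p q A a B b) * exp (s * of_real (ln (H_rho p q A B))) * s ^ m *
     exp ((\<Sum>i=1..0. of_real (H_qcoef p q A a B b i / real i) * (1 / s) ^ i) + R))"
    using H_kernel_expansion [OF A B D mu, of "\<lambda>s. 1" "\<lambda>s. \<bar>Im s\<bar> \<ge> 1" 0,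
        OF _ _ _ Gamma_scaled_strip] by auto
  define nu where "nu = H_nu p q A a B b"
  have nu: "nu > 0" unfolding nu_def using A B by (intro ln_H_nu)
  define L where "L = (\<Sum>k\<le>m. \<bar>H_lcoef p q A a B b (m - k)\<bar>)"
  have L: "L \<ge> 0" by (simp add: L_def sum_nonneg)
  have "norm (H_remainder p q A a B b m s) \<le> nu * (exp C + L) * norm s ^ m"
    if s: "norm s \<ge> r" "\<bar>Im s\<bar> \<ge> 1" for s
  proof -
    obtain R where R: "norm R \<le> C" "H_kernel p q A a B b s =
       of_real nu * exp (s * of_real (ln (H_rho p q A B))) * s ^ m * exp R"
      using rC(3) [of s] s unfolding nu_def by auto
    have "H_kernel p q A a B b s * exp (- s * of_real (ln (H_rho p q A B))) = of_real nu * (s ^ m * exp R)"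
      unfolding R(2) by (simp add: exp_minus)
    hence "H_remainder p q A a B b m s = of_real nu * (s ^ m * exp R - (\<Sum>k\<le>m. of_real (H_lcoef p q A a B b (m - k)) * s ^ k))"
      by (simp add: H_remainder_def nu_def algebra_simps)
    hence "norm (H_remainder p q A a B b m s) = nu * norm (s ^ m * exp R - (\<Sum>k\<le>m. of_real (H_lcoef p q A a B b (m - k)) * s ^ k))"
      using nu by (simp add: norm_mult)
    also have "\<dots> \<le> nu * (norm s ^ m * exp C + L * norm s ^ m)"
    proof (intro mult_left_mono order_trans [OF norm_triangle_ineq4] add_mono)
      show "norm (s ^ m * exp R) \<le> norm s ^ m * exp C"
        unfolding norm_mult norm_power
        by (intro mult_left_mono order_trans [OF norm_exp]) (use R in auto)
      have "norm (of_real (H_lcoef p q A a B b (m - k)) * s ^ k) \<le> \<bar>H_lcoef p q A a B b (m - k)\<bar> * norm s ^ m"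
        if "k \<le> m" for k
        unfolding norm_mult norm_power norm_of_real
        using that s rC by (intro mult_left_mono power_increasing) auto
      thus "norm (\<Sum>k\<le>m. of_real (H_lcoef p q A a B b (m - k)) * s ^ k) \<le> L * norm s ^ m"
        unfolding L_def sum_distrib_right by (intro sum_norm_le) auto
    qed (use nu in auto)
    also have "\<dots> = nu * (exp C + L) * norm s ^ m" by (simp add: algebra_simps)
    finally show ?thesis .
  qed
  moreover have "nu * (exp C + L) \<ge> 0" using nu L by simp
  ultimately show ?thesis using rC(1) by blast
qed

text \<open>The reciprocal Gamma factors are entire, and a pole of a Gamma factor forces s to be
  real with \<open>s \<le> - a k / A k\<close>.\<close>

lemma H_kernel_holomorphic:
  assumes A: "\<And>k. k < p \<Longrightarrow> A k > 0"
  shows "H_kernel p q A a B b holomorphic_on - (complex_of_real ` {..H_gamma p A a})"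
proof -
  have "of_real (A k) * s + of_real (a k) \<notin> \<int>\<^sub>\<le>\<^sub>0"
    if k: "k < p" and s: "s \<notin> complex_of_real ` {..H_gamma p A a}" for k s
  proof
    assume "of_real (A k) * s + of_real (a k) \<in> \<int>\<^sub>\<le>\<^sub>0"
    hence "of_real (A k) * s + of_real (a k) \<in> \<real>\<^sub>\<le>\<^sub>0" using nonpos_Ints_subset_nonpos_Reals by blast
    hence "A k * Im s = 0" "A k * Re s + a k \<le> 0" by (auto simp: complex_nonpos_Reals_iff)
    hence im: "Im s = 0" and re: "Re s \<le> - (a k / A k)" using A [OF k] by (auto simp: field_simps)
    have "Min ((\<lambda>k. a k / A k) ` {..<p}) \<le> a k / A k" using k by (intro Min_le) auto
    hence "Re s \<le> H_gamma p A a" using re by (simp add: H_gamma_def)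
    moreover have "s = of_real (Re s)" using im by (simp add: complex_eq_iff)
    ultimately show False using s by blast
  qed
  thus ?thesis unfolding H_kernel_def
    by (intro holomorphic_intros) auto
qed

lemma H_remainder_holomorphic:
  assumes "\<And>k. k < p \<Longrightarrow> A k > 0"
  shows "H_remainder p q A a B b m holomorphic_on - (complex_of_real ` {..H_gamma p A a})"
  unfolding H_remainder_def by (intro holomorphic_intros H_kernel_holomorphic assms)

section \<open>Mellin transforms of loop integrals\<close>

lemma in_slit_plane_iff: "z \<in> - (complex_of_real ` {..g}) \<longleftrightarrow> Im z \<noteq> 0 \<or> Re z > g"
proof -
  have "z \<in> complex_of_real ` {..g} \<longleftrightarrow> Im z = 0 \<and> Re z \<le> g"
  proof
    assume "Im z = 0 \<and> Re z \<le> g"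
    moreover from this have "z = of_real (Re z)" by (simp add: complex_eq_iff)
    ultimately show "z \<in> complex_of_real ` {..g}" by blast
  qed auto
  thus ?thesis by auto
qed

lemma open_slit_plane: "open (- (complex_of_real ` {..g}))"
proof -
  have "- (complex_of_real ` {..g}) = {z. Im z \<noteq> 0} \<union> {z. Re z > g}"
    using in_slit_plane_iff by auto
  thus ?thesis
    by (auto intro!: open_Un open_Collect_neq open_Collect_less continuous_intros)
qed

lemma slit_plane_primitive:
  assumes "f holomorphic_on - (complex_of_real ` {..g})"
  obtains F where "\<And>z. z \<in> - (complex_of_real ` {..g}) \<Longrightarrow> (F has_field_derivative f z) (at z)"
proof -
  have "\<exists>F. \<forall>z\<in>- (complex_of_real ` {..g}). (F has_field_derivative f z) (at z)"
    using assms open_slit_plane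
    by (intro holomorphic_starlike_primitive [where k = "{}"] starlike_slotted_complex_plane_left)
       (auto intro: holomorphic_on_imp_continuous_on holomorphic_on_imp_differentiable_at)
  thus ?thesis using that by blast
qed

lemma primitive_segment_bound:
  assumes "\<And>z. z \<in> closed_segment u v \<Longrightarrow> (F has_field_derivative f z) (at z)"
    and "\<And>z. z \<in> closed_segment u v \<Longrightarrow> norm (f z) \<le> B"
  shows "norm (F v - F u :: complex) \<le> B * norm (v - u)"
  using assms by (intro field_differentiable_bound [where f' = f and S = "closed_segment u v"])
    (auto intro: has_field_derivative_at_within)

lemma set_integrable_inverse_square: "set_integrable lborel {0..} (\<lambda>t::real. 1 / (1 + t)\<^sup>2)"
proof -
  have "(\<integral>\<^sup>+t. ennreal (1 / (1 + t)\<^sup>2) * indicator {0..} t \<partial>lborel) = ennreal (0 - (- 1 / (1 + 0)))"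
  proof (rule nn_integral_FTC_atLeast)
    show "((\<lambda>t::real. - 1 / (1 + t)) \<longlongrightarrow> 0) at_top"
      by (intro tendsto_divide_0 [OF tendsto_const] filterlim_at_top_imp_at_infinity
           filterlim_tendsto_add_at_top [OF tendsto_const] filterlim_ident)
    show "DERIV (\<lambda>t. - 1 / (1 + t)) t :> 1 / (1 + t)\<^sup>2" if "t \<ge> 0" for t :: real
      using that by (auto intro!: derivative_eq_intros simp: power2_eq_square)
  qed auto
  moreover have "(\<integral>\<^sup>+t. ennreal (indicator {0..} t *\<^sub>R (1 / (1 + t)\<^sup>2)) \<partial>lborel) =
      (\<integral>\<^sup>+t. ennreal (1 / (1 + t)\<^sup>2) * indicator {0..} t \<partial>lborel)"
    by (intro nn_integral_cong) (auto simp: indicator_def)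
  ultimately have "(\<integral>\<^sup>+t. ennreal (indicator {0..} t *\<^sub>R (1 / (1 + t)\<^sup>2)) \<partial>lborel) = ennreal 1"
    by simp
  thus ?thesis unfolding set_integrable_def
    by (intro integrableI_nn_integral_finite [where x = 1]) auto
qed

lemma set_integrable_atLeast0_bound:
  fixes f :: "real \<Rightarrow> 'a :: {banach, second_countable_topology}"
  assumes "continuous_on {0..} f" "\<And>t. t \<ge> 0 \<Longrightarrow> norm (f t) \<le> K / (1 + t)\<^sup>2"
  shows "set_integrable lborel {0..} f"
proof (rule set_integrable_bound)
  show "set_integrable lborel {0..} (\<lambda>t::real. K * (1 / (1 + t)\<^sup>2))"
    using set_integrable_inverse_square by (intro set_integrable_mult_right)
  show "set_borel_measurable lborel {0..} f"
    using borel_measurable_continuous_on_indicator [OF _ assms(1)] by (simp add: set_borel_measurable_def)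
  show "AE t in lborel. t \<in> {0..} \<longrightarrow> norm (f t) \<le> norm (K * (1 / (1 + t)\<^sup>2))"
  proof (rule AE_I2, rule impI)
    fix t :: real assume "t \<in> {0..}"
    hence "norm (f t) \<le> K / (1 + t)\<^sup>2" using assms by auto
    thus "norm (f t) \<le> norm (K * (1 / (1 + t)\<^sup>2))"
      by (rule order_trans) (simp add: divide_right_mono)
  qed
qed

text \<open>The square of \<open>1 + t \<le> (1 + 2 / L) * (1 + L * t / 2)\<close>, combined with
  \<open>1 + y \<le> exp y\<close>. It brings exponential decay under the majorant
  \<open>1 / (1 + t) ^ 2\<close> used for all integrals over rays.\<close>

lemma exp_le_inverse_square:
  fixes L t :: real
  assumes "L > 0" "t \<ge> 0"
  shows "exp (- (L * t)) \<le> (1 + 2 / L)\<^sup>2 / (1 + t)\<^sup>2"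
proof -
  have "1 + t \<le> (1 + 2 / L) * (1 + L * t / 2)"
    using assms by (simp add: field_simps)
  also have "\<dots> \<le> (1 + 2 / L) * exp (L * t / 2)"
    using assms exp_ge_add_one_self [of "L * t / 2"] by (intro mult_left_mono) auto
  finally have "(1 + t)\<^sup>2 \<le> ((1 + 2 / L) * exp (L * t / 2))\<^sup>2"
    using assms by (intro power_mono) auto
  also have "\<dots> = (1 + 2 / L)\<^sup>2 * exp (L * t)"
    by (simp add: power_mult_distrib exp_double [symmetric])
  finally show ?thesis
    using assms by (simp add: exp_minus field_simps)
qed

lemma tendsto_integral_antiderivative_at_top:
  fixes f F :: "real \<Rightarrow> complex"
  assumes F: "\<And>t. t \<ge> 0 \<Longrightarrow> (F has_vector_derivative f t) (at t)"
    and cont: "continuous_on {0..} f" and int: "set_integrable lborel {0..} f"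
  shows "((\<lambda>T. F T - F 0) \<longlongrightarrow> (LINT t:{0..}|lborel. f t)) at_top"
proof -
  have "((\<lambda>T. \<integral>t. indicator {..T} t *\<^sub>R (indicator {0..} t *\<^sub>R f t) \<partial>lborel) \<longlongrightarrow>
       (LINT t:{0..}|lborel. f t)) at_top"
    using int unfolding set_integrable_def set_lebesgue_integral_def
    by (intro tendsto_integral_at_top) auto
  moreover have "eventually (\<lambda>T. (\<integral>t. indicator {..T} t *\<^sub>R (indicator {0..} t *\<^sub>R f t) \<partial>lborel) = F T - F 0) at_top"
    using eventually_ge_at_top [of 0]
  proof eventually_elim
    case (elim T)
    have "(\<integral>t. indicator {..T} t *\<^sub>R (indicator {0..} t *\<^sub>R f t) \<partial>lborel) =
          (\<integral>t. indicator {0..T} t *\<^sub>R f t \<partial>lborel)"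
      by (intro Bochner_Integration.integral_cong) (auto simp: indicator_def)
    also have "\<dots> = F T - F 0"
      using elim cont by (intro integral_FTC_atLeastAtMost)
        (auto intro: has_vector_derivative_at_within F continuous_on_subset)
    finally show ?case .
  qed
  ultimately show ?thesis by (rule Lim_transform_eventually)
qed

lemma tendsto_power_times_exp_neg:
  fixes L :: real
  assumes "L > 0"
  shows "((\<lambda>R. R ^ n * exp (- (R * L))) \<longlongrightarrow> 0) at_top"
proof -
  have "filterlim (\<lambda>R. R * L) at_top at_top"
    using assms by (intro filterlim_at_top_mult_tendsto_pos [OF tendsto_const]) (auto simp: filterlim_ident)
  from filterlim_compose [OF tendsto_power_div_exp_0 [of n] this]
  have "((\<lambda>R. 1 / L ^ n * ((R * L) ^ n / exp (R * L))) \<longlongrightarrow> 1 / L ^ n * 0) at_top"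
    by (intro tendsto_mult tendsto_const)
  also have "(\<lambda>R. 1 / L ^ n * ((R * L) ^ n / exp (R * L))) = (\<lambda>R. R ^ n * exp (- (R * L)))"
    using assms by (simp add: fun_eq_iff power_mult_distrib exp_minus field_simps)
  finally show ?thesis by simp
qed

text \<open>The directions will be \<open>e = -1 \<plusminus> 2 * \<i>\<close>: up to a bounded part these rays lie in the sector
  \<open>Re s \<ge> - \<bar>Im s\<bar>\<close>, whatever the sign of \<open>d\<close>.\<close>
definition ray :: "real \<Rightarrow> complex \<Rightarrow> real \<Rightarrow> complex" where
  "ray d e t = of_real d + of_real t * e"

lemma Re_ray [simp]: "Re (ray d e t) = d + t * Re e" and Im_ray [simp]: "Im (ray d e t) = t * Im e"
  by (simp_all add: ray_def)

lemma ray_0 [simp]: "ray d e 0 = of_real d"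
  by (simp add: ray_def)

lemma has_vector_derivative_ray [derivative_intros]: "(ray d e has_vector_derivative e) (at t within S)"
  unfolding ray_def by (auto intro!: derivative_eq_intros)

lemma continuous_on_ray [continuous_intros]: "continuous_on S (ray d e)"
  unfolding ray_def by (intro continuous_intros)

lemma ray_in_slit_plane:
  assumes "d > g" "Im e \<noteq> 0" "t \<ge> 0"
  shows "ray d e t \<in> - (complex_of_real ` {..g})"
  unfolding in_slit_plane_iff using assms by (cases "t = 0") auto

lemma ray_bound:
  assumes holo: "k holomorphic_on - (complex_of_real ` {..g})"
    and sec: "\<And>s. norm s \<ge> r \<Longrightarrow> Re s \<ge> - \<bar>Im s\<bar> \<Longrightarrow> norm (k s) \<le> C / norm s"
    and d: "d > g" and e: "Re e = -1" "\<bar>Im e\<bar> = 2"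
  shows "\<exists>K\<ge>0. \<forall>t\<ge>0. norm (k (ray d e t)) \<le> K / (1 + t)"
proof -
  \<comment> \<open>From \<open>\<bar>d\<bar>\<close> on the ray lies in the sector, from r on its
    points are large enough for \<open>sec\<close>, and from 1 on \<open>2 * t \<ge> 1 + t\<close>.
    The part before \<open>t0\<close> is compact.\<close>
  define t0 where "t0 = max 1 (max r \<bar>d\<bar>)"
  have "continuous_on {0..t0} (\<lambda>t. k (ray d e t))"
    using e d by (intro continuous_on_compose2 [OF holomorphic_on_imp_continuous_on [OF holo]] continuous_intros
       image_subsetI ray_in_slit_plane) auto
  hence "bounded ((\<lambda>t. k (ray d e t)) ` {0..t0})"
    by (intro compact_imp_bounded compact_continuous_image) auto
  then obtain M where M: "M > 0" "\<And>t. t \<in> {0..t0} \<Longrightarrow> norm (k (ray d e t)) \<le> M"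
    unfolding bounded_pos by auto
  define K where "K = M * (1 + t0) + \<bar>C\<bar>"
  have t0: "t0 \<ge> 1" "t0 \<ge> r" "t0 \<ge> \<bar>d\<bar>" by (auto simp: t0_def)
  have K: "K \<ge> 0" using M t0 by (simp add: K_def)
  have "norm (k (ray d e t)) \<le> K / (1 + t)" if t: "t \<ge> 0" for t
  proof (cases "t \<le> t0")
    case True
    have "norm (k (ray d e t)) * (1 + t) \<le> M * (1 + t0)"
      using M True t by (intro mult_mono) auto
    hence "norm (k (ray d e t)) * (1 + t) \<le> K" by (simp add: K_def)
    thus ?thesis using t by (simp add: field_simps)
  next
    case False
    have im: "\<bar>Im (ray d e t)\<bar> = 2 * t" using e t by (simp add: abs_mult)
    have big: "norm (ray d e t) \<ge> 2 * t" using abs_Im_le_cmod [of "ray d e t"] im by simp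
    have "norm (k (ray d e t)) \<le> C / norm (ray d e t)"
      using False t0 t big im e by (intro sec) auto
    also have "\<dots> \<le> \<bar>C\<bar> / norm (ray d e t)" by (intro divide_right_mono) auto
    also have "\<dots> \<le> \<bar>C\<bar> / (1 + t)" using big False t0 by (intro divide_left_mono mult_pos_pos) auto
    also have "\<dots> \<le> K / (1 + t)" using M t0 t by (intro divide_right_mono) (auto simp: K_def)
    finally show ?thesis .
  qed
  with K show ?thesis by blast
qed

section \<open>From the loop to two rays\<close>

text \<open>Only the end points enter, so the abscissa c of the vertical side does not affect the
  value as long as it lies to the right of the slit.\<close>

lemma contour_integral_trunc_loop_primitive:
  assumes F: "\<And>z. z \<in> - (complex_of_real ` {..g}) \<Longrightarrow> (F has_field_derivative f z) (at z)" and c: "c > g"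
  shows "(f has_contour_integral (F (Complex (- R) 1) - F (Complex (- R) (- 1)))) (trunc_loop c (- 1) 1 R)"
proof -
  have seg1: "closed_segment (Complex x y) (Complex x' y) \<subseteq> - (complex_of_real ` {..g})" if "y \<noteq> 0" for x x' y
    using that by (auto simp: in_slit_plane_iff closed_segment_same_Im simp del: Compl_iff)
  have seg2: "closed_segment (Complex c y) (Complex c y') \<subseteq> - (complex_of_real ` {..g})" for y y'
    using c by (auto simp: in_slit_plane_iff closed_segment_same_Re simp del: Compl_iff)
  have "path_image (trunc_loop c (- 1) 1 R) \<subseteq> - (complex_of_real ` {..g})"
    unfolding trunc_loop_def using seg1 [of 1] seg1 [of "-1"] seg2
    by (auto simp: path_image_join simp del: Compl_iff)
  moreover have "valid_path (trunc_loop c (- 1) 1 R)"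
    unfolding trunc_loop_def by (intro valid_path_join) auto
  moreover have "pathstart (trunc_loop c (- 1) 1 R) = Complex (- R) (- 1)"
      "pathfinish (trunc_loop c (- 1) 1 R) = Complex (- R) 1"
    by (simp_all add: trunc_loop_def)
  ultimately show ?thesis
    using contour_integral_primitive [of "- (complex_of_real ` {..g})" F f "trunc_loop c (- 1) 1 R"] F
    by (metis has_field_derivative_at_within)
qed

lemma continuous_on_ray_compose:
  assumes "k holomorphic_on - (complex_of_real ` {..g})" "d > g" "Im e \<noteq> 0"
  shows "continuous_on {0..} (\<lambda>t. k (ray d e t))"
  using assms by (intro continuous_on_compose2 [OF holomorphic_on_imp_continuous_on [OF assms(1)]]
     continuous_intros image_subsetI ray_in_slit_plane) auto

lemma set_integrable_ray_exp:
  assumes holo: "k holomorphic_on - (complex_of_real ` {..g})"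
    and sec: "\<And>s. norm s \<ge> r \<Longrightarrow> Re s \<ge> - \<bar>Im s\<bar> \<Longrightarrow> norm (k s) \<le> C / norm s"
    and d: "d > g" and e: "Re e = -1" "\<bar>Im e\<bar> = 2" and L: "L > 0"
  shows "set_integrable lborel {0..} (\<lambda>t. k (ray d e t) * exp (ray d e t * of_real L))"
proof -
  obtain K where K: "K \<ge> 0" "\<And>t. t \<ge> 0 \<Longrightarrow> norm (k (ray d e t)) \<le> K / (1 + t)"
    using ray_bound [OF holo sec d e] by blast
  show ?thesis
  proof (rule set_integrable_atLeast0_bound)
    show "continuous_on {0..} (\<lambda>t. k (ray d e t) * exp (ray d e t * of_real L))"
      using e by (intro continuous_intros continuous_on_ray_compose [OF holo d]) auto
    fix t :: real assume t: "t \<ge> 0"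
    have "norm (k (ray d e t) * exp (ray d e t * of_real L)) = norm (k (ray d e t)) * (exp (d * L) * exp (- (L * t)))"
      by (simp add: norm_mult e exp_add [symmetric] algebra_simps)
    also have "\<dots> \<le> K * (exp (d * L) * ((1 + 2 / L)\<^sup>2 / (1 + t)\<^sup>2))"
    proof (intro mult_mono order_refl exp_le_inverse_square L t)
      have "K / (1 + t) \<le> K / 1" using t K by (intro divide_left_mono) auto
      thus "norm (k (ray d e t)) \<le> K" using K(2) [OF t] by simp
    qed (use K in auto)
    finally show "norm (k (ray d e t) * exp (ray d e t * of_real L)) \<le> K * exp (d * L) * (1 + 2 / L)\<^sup>2 / (1 + t)\<^sup>2"
      by simp
  qed
qed

text \<open>The segment joins an end of the truncated loop to the point of the ray with the same
  real part \<open>- R\<close>. It leaves the sector, so only the polynomial bound is at hand. From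
  \<open>\<bar>d\<bar> \<le> R - 1\<close> follow height and length at most \<open>4 * R\<close> and
  \<open>norm z \<le> 5 * R\<close>.\<close>

lemma primitive_vertical_bound:
  assumes F: "\<And>z. z \<in> - (complex_of_real ` {..g}) \<Longrightarrow> (F has_field_derivative k z * exp (z * of_real L)) (at z)"
    and strip: "\<And>s. norm s \<ge> r \<Longrightarrow> \<bar>Im s\<bar> \<ge> 1 \<Longrightarrow> norm (k s) \<le> C * norm s ^ m"
    and C: "C \<ge> 0" and y: "\<bar>y\<bar> = 1" and R: "R \<ge> 1" "R \<ge> r" "R \<ge> \<bar>d\<bar> + 1"
  shows "norm (F (Complex (- R) (2 * (R + d) * y)) - F (Complex (- R) y)) \<le> (C * 5 ^ m * 4) * (R ^ (m + 1) * exp (- (R * L)))"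
proof -
  define u v where "u = Complex (- R) y" and "v = Complex (- R) (2 * (R + d) * y)"
  have seg: "Re z = - R \<and> 1 \<le> \<bar>Im z\<bar> \<and> \<bar>Im z\<bar> \<le> 4 * R" if "z \<in> closed_segment u v" for z
  proof -
    have z: "Re z = - R" "Im z \<in> closed_segment y (2 * (R + d) * y)"
      using that by (auto simp: u_def v_def closed_segment_same_Re)
    have "R + d \<ge> 1" "2 * (R + d) \<le> 4 * R" using R by auto
    moreover have "y = 1 \<or> y = -1" using y by auto
    ultimately show ?thesis using z by (auto simp: closed_segment_eq_real_ivl split: if_splits)
  qed
  have "norm (F v - F u) \<le> (C * (5 * R) ^ m * exp (- (R * L))) * norm (v - u)"
  proof (rule primitive_segment_bound [where f = "\<lambda>z. k z * exp (z * of_real L)"])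
    fix z assume z: "z \<in> closed_segment u v"
    note s = seg [OF z]
    show "(F has_field_derivative k z * exp (z * of_real L)) (at z)"
      by (rule F, unfold in_slit_plane_iff) (use s in auto)
    have "norm z \<ge> r" using abs_Re_le_cmod [of z] s R by auto
    hence "norm (k z) \<le> C * norm z ^ m" using s by (intro strip) auto
    also have "\<dots> \<le> C * (5 * R) ^ m"
      using cmod_le [of z] s R C by (intro mult_left_mono power_mono) auto
    finally show "norm (k z * exp (z * of_real L)) \<le> C * (5 * R) ^ m * exp (- (R * L))"
      using s by (simp add: norm_mult mult_right_mono)
  qed
  also have "norm (v - u) \<le> 4 * R"
  proof -
    have "v - u = of_real ((2 * (R + d) - 1) * y) * \<i>"
      by (simp add: u_def v_def complex_eq_iff algebra_simps)
    hence "norm (v - u) = \<bar>2 * (R + d) - 1\<bar>" using y by (simp add: norm_mult abs_mult del: of_real_mult of_real_diff)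
    thus ?thesis using R by auto
  qed
  hence "(C * (5 * R) ^ m * exp (- (R * L))) * norm (v - u) \<le> (C * (5 * R) ^ m * exp (- (R * L))) * (4 * R)"
    using C R by (intro mult_left_mono) auto
  also have "\<dots> = (C * 5 ^ m * 4) * (R ^ (m + 1) * exp (- (R * L)))"
    by (simp add: power_mult_distrib)
  finally show ?thesis by (simp add: u_def v_def)
qed

lemma loop_integral_tendsto:
  assumes holo: "k holomorphic_on - (complex_of_real ` {..g})"
    and sec: "\<And>s. norm s \<ge> r \<Longrightarrow> Re s \<ge> - \<bar>Im s\<bar> \<Longrightarrow> norm (k s) \<le> C / norm s"
    and strip: "\<And>s. norm s \<ge> r \<Longrightarrow> \<bar>Im s\<bar> \<ge> 1 \<Longrightarrow> norm (k s) \<le> C * norm s ^ m"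
    and C: "C \<ge> 0" and d: "d > g" and c: "c > g" and L: "L > 0"
    and e1: "e1 = Complex (-1) 2" and e2: "e2 = Complex (-1) (-2)"
  shows "((\<lambda>R. contour_integral (trunc_loop c (- 1) 1 R) (\<lambda>s. k s * exp (s * of_real L))) \<longlongrightarrow>
     e1 * (LINT t:{0..}|lborel. k (ray d e1 t) * exp (ray d e1 t * of_real L)) -
     e2 * (LINT t:{0..}|lborel. k (ray d e2 t) * exp (ray d e2 t * of_real L))) at_top"
proof -
  define f where "f = (\<lambda>s. k s * exp (s * of_real L))"
  have hf: "f holomorphic_on - (complex_of_real ` {..g})"
    unfolding f_def by (intro holomorphic_intros holo)
  obtain F where F: "\<And>z. z \<in> - (complex_of_real ` {..g}) \<Longrightarrow> (F has_field_derivative f z) (at z)"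
    using slit_plane_primitive [OF hf] by blast
  have int: "set_integrable lborel {0..} (\<lambda>t. f (ray d e t))" if "e \<in> {e1, e2}" for e
    unfolding f_def using that e1 e2 by (intro set_integrable_ray_exp [OF holo sec d] L) auto
  have lim1: "((\<lambda>T. F (ray d e T) - F (ray d e 0)) \<longlongrightarrow> e * (LINT t:{0..}|lborel. f (ray d e t))) at_top"
    if e: "e \<in> {e1, e2}" for e
  proof -
    have "((\<lambda>T. F (ray d e T) - F (ray d e 0)) \<longlongrightarrow> (LINT t:{0..}|lborel. e * f (ray d e t))) at_top"
    proof (rule tendsto_integral_antiderivative_at_top)
      show "continuous_on {0..} (\<lambda>t. e * f (ray d e t))"
        using e e1 e2 by (intro continuous_intros continuous_on_ray_compose [OF hf d]) auto
      show "set_integrable lborel {0..} (\<lambda>t. e * f (ray d e t))"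
        using int [OF e] by (intro set_integrable_mult_right)
      fix t :: real assume "t \<ge> 0"
      hence "(F has_field_derivative f (ray d e t)) (at (ray d e t))"
        using e e1 e2 d by (intro F ray_in_slit_plane) auto
      from field_vector_diff_chain_at [OF has_vector_derivative_ray this]
      show "((\<lambda>t. F (ray d e t)) has_vector_derivative e * f (ray d e t)) (at t)"
        by (simp add: o_def)
    qed
    thus ?thesis by simp
  qed
  define I where "I = e1 * (LINT t:{0..}|lborel. f (ray d e1 t)) - e2 * (LINT t:{0..}|lborel. f (ray d e2 t))"
  have "((\<lambda>T. (F (ray d e1 T) - F (ray d e1 0)) - (F (ray d e2 T) - F (ray d e2 0))) \<longlongrightarrow> I) at_top"
    unfolding I_def by (intro tendsto_diff lim1) auto
  \<comment> \<open>Both rays start at d, so the starting values cancel.\<close>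
  hence "((\<lambda>T. F (ray d e1 T) - F (ray d e2 T)) \<longlongrightarrow> I) at_top" by simp
  moreover have "filterlim (\<lambda>R. R + d) at_top at_top"
    by (subst add.commute, rule filterlim_tendsto_add_at_top [OF tendsto_const filterlim_ident])
  ultimately have lim2: "((\<lambda>R. F (ray d e1 (R + d)) - F (ray d e2 (R + d))) \<longlongrightarrow> I) at_top"
    by (rule filterlim_compose)
  \<comment> \<open>At the parameter \<open>R + d\<close> the rays are level with the ends of the
    truncated loop.\<close>
  have ray_eq: "ray d e1 (R + d) = Complex (- R) (2 * (R + d) * 1)" "ray d e2 (R + d) = Complex (- R) (2 * (R + d) * (- 1))" for R
    by (simp_all add: complex_eq_iff e1 e2)
  have lim3: "((\<lambda>R. F (Complex (- R) (2 * (R + d) * y)) - F (Complex (- R) y)) \<longlongrightarrow> 0) at_top" if y: "\<bar>y\<bar> = 1" for y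
  proof (rule Lim_null_comparison)
    show "((\<lambda>R. (C * 5 ^ m * 4) * (R ^ (m + 1) * exp (- (R * L)))) \<longlongrightarrow> 0) at_top"
      using tendsto_mult [OF tendsto_const tendsto_power_times_exp_neg [OF L, of "m + 1"], of "C * 5 ^ m * 4"] by simp
    show "\<forall>\<^sub>F R in at_top. norm (F (Complex (- R) (2 * (R + d) * y)) - F (Complex (- R) y))
       \<le> (C * 5 ^ m * 4) * (R ^ (m + 1) * exp (- (R * L)))"
      using eventually_ge_at_top [of 1] eventually_ge_at_top [of r] eventually_ge_at_top [of "\<bar>d\<bar> + 1"]
    proof eventually_elim
      case (elim R)
      show ?case
        by (rule primitive_vertical_bound [OF F [unfolded f_def] strip C y elim])
    qed
  qed
  have "((\<lambda>R. (F (ray d e1 (R + d)) - F (ray d e2 (R + d)))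
      - (F (Complex (- R) (2 * (R + d) * 1)) - F (Complex (- R) 1))
      + (F (Complex (- R) (2 * (R + d) * (- 1))) - F (Complex (- R) (- 1)))) \<longlongrightarrow> I - 0 + 0) at_top"
    by (intro tendsto_add tendsto_diff lim2 lim3) auto
  hence "((\<lambda>R. F (Complex (- R) 1) - F (Complex (- R) (- 1))) \<longlongrightarrow> I) at_top"
    unfolding ray_eq by simp
  moreover have "contour_integral (trunc_loop c (- 1) 1 R) f = F (Complex (- R) 1) - F (Complex (- R) (- 1))" for R
    by (intro contour_integral_unique contour_integral_trunc_loop_primitive [OF F c])
  ultimately show ?thesis by (simp add: I_def f_def)
qed

text \<open>The integrand is entire, so the truncated loop may be replaced by the short segment
  between its ends, straight across the real axis, where the exponential is
  \<open>exp (- (R * L))\<close> in norm.\<close>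

lemma loop_integral_polynomial_tendsto_0:
  fixes a :: "nat \<Rightarrow> complex"
  assumes L: "L > 0"
  shows "((\<lambda>R. contour_integral (trunc_loop c (- 1) 1 R) (\<lambda>s. (\<Sum>i\<le>m. a i * s ^ i) * exp (s * of_real L))) \<longlongrightarrow> 0) at_top"
proof -
  define k where "k = (\<lambda>s. \<Sum>i\<le>m. a i * s ^ i)"
  define f where "f = (\<lambda>s. k s * exp (s * of_real L))"
  define C where "C = (\<Sum>i\<le>m. norm (a i))"
  have C: "C \<ge> 0" by (simp add: C_def sum_nonneg)
  have hf: "f holomorphic_on UNIV" unfolding f_def k_def by (intro holomorphic_intros)
  have "\<exists>F. \<forall>z\<in>UNIV. (F has_field_derivative f z) (at z)"
    using hf by (intro holomorphic_starlike_primitive [where k = "{}"])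
      (auto intro: holomorphic_on_imp_continuous_on holomorphic_on_imp_differentiable_at simp: starlike_def)
  then obtain F where F: "\<And>z. (F has_field_derivative f z) (at z)" by blast
  have bound: "norm (k z) \<le> C * norm z ^ m" if "norm z \<ge> 1" for z
    unfolding k_def C_def sum_distrib_right using that
    by (intro sum_norm_le) (auto simp: norm_mult norm_power intro!: mult_left_mono power_increasing)
  have "((\<lambda>R. F (Complex (- R) 1) - F (Complex (- R) (- 1))) \<longlongrightarrow> 0) at_top"
  proof (rule Lim_null_comparison)
    show "((\<lambda>R. (C * 2 ^ m * 2) * (R ^ m * exp (- (R * L)))) \<longlongrightarrow> 0) at_top"
      using tendsto_mult [OF tendsto_const tendsto_power_times_exp_neg [OF L, of m], of "C * 2 ^ m * 2"] by simp
    show "\<forall>\<^sub>F R in at_top. norm (F (Complex (- R) 1) - F (Complex (- R) (- 1))) \<le> (C * 2 ^ m * 2) * (R ^ m * exp (- (R * L)))"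
      using eventually_ge_at_top [of 1]
    proof eventually_elim
      case (elim R)
      have "norm (F (Complex (- R) 1) - F (Complex (- R) (- 1))) \<le>
         (C * (2 * R) ^ m * exp (- (R * L))) * norm (Complex (- R) 1 - Complex (- R) (- 1))"
      proof (rule primitive_segment_bound [where f = f, OF F])
        fix z assume "z \<in> closed_segment (Complex (- R) (- 1)) (Complex (- R) 1)"
        hence z: "Re z = - R" "\<bar>Im z\<bar> \<le> 1"
          by (auto simp: closed_segment_same_Re closed_segment_eq_real_ivl)
        have "norm z \<ge> 1" using abs_Re_le_cmod [of z] z elim by auto
        hence "norm (k z) \<le> C * norm z ^ m" by (rule bound)
        also have "\<dots> \<le> C * (2 * R) ^ m"
          using cmod_le [of z] z elim C by (intro mult_left_mono power_mono) auto
        finally show "norm (f z) \<le> C * (2 * R) ^ m * exp (- (R * L))"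
          using z by (simp add: f_def norm_mult mult_right_mono)
      qed
      also have "Complex (- R) 1 - Complex (- R) (- 1) = 2 * \<i>" by (simp add: complex_eq_iff)
      finally show ?case by (simp add: power_mult_distrib norm_mult mult_ac)
    qed
  qed
  moreover have "contour_integral (trunc_loop c (- 1) 1 R) f = F (Complex (- R) 1) - F (Complex (- R) (- 1))" for R
    by (intro contour_integral_unique contour_integral_trunc_loop_primitive [of "c - 1"] F) auto
  ultimately show ?thesis by (simp add: f_def k_def)
qed

section \<open>The Mellin transform of an integral over one ray\<close>

text \<open>Powers of x are written through the real logarithm, which makes measurability immediate.
  The integral of the norm is what Fubini's theorem asks for.\<close>

lemma exp_ln_integral:
  fixes z :: complex and \<rho> :: real
  assumes z: "Re z > 0" and rho: "\<rho> > 0"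
  shows "set_integrable lborel {0<..<\<rho>} (\<lambda>x. exp ((z - 1) * of_real (ln x)))" (is ?int)
    and "(LINT x:{0<..<\<rho>}|lborel. exp ((z - 1) * of_real (ln x))) = exp (z * of_real (ln \<rho>)) / z"
    and "(LINT x:{0<..<\<rho>}|lborel. norm (exp ((z - 1) * of_real (ln x)))) = exp (Re z * ln \<rho>) / Re z"
proof -
  have eq: "x powr (Re z - 1) = norm (exp ((z - 1) * of_real (ln x)))" if "x \<in> {0<..<\<rho>}" for x
    using that by (simp add: powr_def)
  have "((\<lambda>x. x powr (Re z - 1)) has_integral (\<rho> powr Re z / Re z)) {0..\<rho>}"
    using has_integral_powr_from_0 [of "Re z - 1" \<rho>] z rho by simp
  hence "((\<lambda>x. x powr (Re z - 1)) has_integral (\<rho> powr Re z / Re z)) {0<..<\<rho>}"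
    by (simp add: has_integral_Icc_iff_Ioo)
  hence real: "((\<lambda>x. norm (exp ((z - 1) * of_real (ln x)))) has_integral (exp (Re z * ln \<rho>) / Re z)) {0<..<\<rho>}"
    using rho eq by (subst (asm) has_integral_cong [OF eq]) (auto simp: powr_def)
  have meas: "(\<lambda>x. indicator {0<..<\<rho>} x *\<^sub>R exp ((z - 1) * of_real (ln x))) \<in> borel_measurable borel"
    by measurable
  have "(\<lambda>x. norm (exp ((z - 1) * of_real (ln x)))) absolutely_integrable_on {0<..<\<rho>}"
    using real by (intro nonnegative_absolutely_integrable_1) auto
  hence normint: "set_integrable lborel {0<..<\<rho>} (\<lambda>x. norm (exp ((z - 1) * of_real (ln x))))"
    unfolding set_integrable_def by (subst (asm) integrable_completion) auto
  show int: ?int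
    by (rule set_integrable_bound [OF normint]) (use meas in \<open>auto simp: set_borel_measurable_def\<close>)
  show "(LINT x:{0<..<\<rho>}|lborel. norm (exp ((z - 1) * of_real (ln x)))) = exp (Re z * ln \<rho>) / Re z"
    using set_borel_integral_eq_integral(2) [OF normint] real by (simp add: integral_unique)
  have z0: "z \<noteq> 0" using z by auto
  \<comment> \<open>\<open>0 powr z = 0\<close> by convention; for \<open>Re z > 0\<close> this is
    the continuous extension, and the lower end contributes nothing.\<close>
  define F where "F = (\<lambda>x. of_real x powr z / z)"
  have "((\<lambda>x. exp ((z - 1) * of_real (ln x))) has_integral F \<rho> - F 0) {0..\<rho>}"
  proof (rule fundamental_theorem_of_calculus_interior)
    show "continuous_on {0..\<rho>} F"
      unfolding F_def using z z0
      by (intro continuous_on_divide continuous_on_powr_complex continuous_intros) auto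
    fix x assume x: "x \<in> {0<..<\<rho>}"
    have "((\<lambda>w. w powr z / z) has_field_derivative of_real x powr (z - 1)) (at (of_real x))"
      using x z0 by (auto intro!: derivative_eq_intros simp: complex_nonpos_Reals_iff)
    hence "((\<lambda>x. of_real x powr z / z) has_vector_derivative of_real x powr (z - 1)) (at x)"
      by (rule has_vector_derivative_real_field)
    thus "(F has_vector_derivative exp ((z - 1) * of_real (ln x))) (at x)"
      using x by (simp add: F_def powr_def Ln_of_real)
  qed (use rho in auto)
  hence "((\<lambda>x. exp ((z - 1) * of_real (ln x))) has_integral F \<rho> - F 0) {0<..<\<rho>}"
    by (simp add: has_integral_Icc_iff_Ioo)
  thus "(LINT x:{0<..<\<rho>}|lborel. exp ((z - 1) * of_real (ln x))) = exp (z * of_real (ln \<rho>)) / z"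
    using set_borel_integral_eq_integral(2) [OF int] rho
    by (simp add: integral_unique F_def powr_def Ln_of_real)
qed

text \<open>For fixed w the integral of \<open>exp (w * (ln \<rho> - ln x))\<close> against
  \<open>x powr (s0 - 1)\<close> is \<open>\<rho> powr s0 / (s0 - w)\<close>, as the powers of
  \<rho> with exponent w cancel. It converges because \<open>Re w \<le> d < Re s0\<close>.\<close>

lemma mellin_ray:
  assumes holo: "k holomorphic_on - (complex_of_real ` {..g})"
    and sec: "\<And>s. norm s \<ge> r \<Longrightarrow> Re s \<ge> - \<bar>Im s\<bar> \<Longrightarrow> norm (k s) \<le> C / norm s"
    and d: "d > g" and e: "Re e = -1" "\<bar>Im e\<bar> = 2" and s0: "Re s0 > d" and rho: "\<rho> > 0"
  defines "J \<equiv> (\<lambda>x. LINT t:{0..}|lborel. k (ray d e t) * exp (ray d e t * of_real (ln \<rho> - ln x)))"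
  shows "set_integrable lborel {0..} (\<lambda>t. k (ray d e t) / (s0 - ray d e t))" (is ?A)
    and "set_integrable lborel {0<..<\<rho>} (\<lambda>x. J x * exp ((s0 - 1) * of_real (ln x)))" (is ?B)
    and "(LINT x:{0<..<\<rho>}|lborel. J x * exp ((s0 - 1) * of_real (ln x))) =
         exp (s0 * of_real (ln \<rho>)) * (LINT t:{0..}|lborel. k (ray d e t) / (s0 - ray d e t))" (is ?C)
proof -
  define w where "w = ray d e"
  have Rew: "Re (w t) = d - t" for t by (simp add: w_def e)
  have Rew_pos: "Re (s0 - w t) > 0" if "t \<ge> 0" for t using that s0 by (simp add: Rew)
  have ne: "s0 - w t \<noteq> 0" if "t \<ge> 0" for t using Rew_pos [OF that] by auto
  have contk: "continuous_on {0..} (\<lambda>t. k (w t))"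
    unfolding w_def using e by (intro continuous_on_ray_compose [OF holo d]) auto
  have contw: "continuous_on S w" for S unfolding w_def by (intro continuous_intros)
  obtain K where K: "K \<ge> 0" "\<And>t. t \<ge> 0 \<Longrightarrow> norm (k (w t)) \<le> K / (1 + t)"
    using ray_bound [OF holo sec d e] unfolding w_def by blast
  \<comment> \<open>\<open>Re (s0 - w t)\<close> equals \<open>Re s0 - d + t\<close>, so h is a
    slope for which this is at least \<open>h * (1 + t)\<close>.\<close>
  define h where "h = min 1 (Re s0 - d)"
  have h: "h > 0" "h \<le> 1" "h \<le> Re s0 - d" using s0 by (auto simp: h_def)
  have low: "Re (s0 - w t) \<ge> h * (1 + t)" if "t \<ge> 0" for t
    using h that mult_right_mono [of h 1 t] by (simp add: Rew algebra_simps)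
  have dec: "norm (k (w t)) / Re (s0 - w t) \<le> K / h / (1 + t)\<^sup>2" if t: "t \<ge> 0" for t
  proof -
    have "norm (k (w t)) / Re (s0 - w t) \<le> (K / (1 + t)) / (h * (1 + t))"
      using K(2) [OF t] K(1) low [OF t] h t by (intro frac_le) auto
    also have "\<dots> = K / h / (1 + t)\<^sup>2" by (simp add: power2_eq_square)
    finally show ?thesis .
  qed
  show ?A unfolding w_def [symmetric]
  proof (rule set_integrable_atLeast0_bound)
    show "continuous_on {0..} (\<lambda>t. k (w t) / (s0 - w t))"
      using ne by (intro continuous_on_divide contk continuous_on_diff continuous_on_const contw) auto
    fix t :: real assume t: "t \<ge> 0"
    have "norm (k (w t) / (s0 - w t)) \<le> norm (k (w t)) / Re (s0 - w t)"
      unfolding norm_divide using Rew_pos [OF t] complex_Re_le_cmod [of "s0 - w t"]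
      by (intro divide_left_mono mult_pos_pos) (auto simp del: minus_complex.simps)
    thus "norm (k (w t) / (s0 - w t)) \<le> K / h / (1 + t)\<^sup>2" using dec [OF t] by linarith
  qed
  define f where "f = (\<lambda>t x. indicator {0..} t *\<^sub>R (indicator {0<..<\<rho>} x *\<^sub>R
      (k (w t) * exp (w t * of_real (ln \<rho> - ln x)) * exp ((s0 - 1) * of_real (ln x)))))"
  \<comment> \<open>Here x occurs only in a power, so the inner integral is explicit; the form
    \<open>f_alt2\<close> below serves for joint measurability.\<close>
  have f_alt: "f t x = (indicator {0..} t *\<^sub>R (k (w t) * exp (w t * of_real (ln \<rho>)))) *
      (indicator {0<..<\<rho>} x *\<^sub>R exp ((s0 - w t - 1) * of_real (ln x)))" for t x
    by (simp add: f_def exp_add [symmetric] exp_diff exp_minus indicator_def algebra_simps flip: exp_add)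
  have kk [measurable]: "(\<lambda>t. indicator {0..} t *\<^sub>R k (w t)) \<in> borel_measurable borel"
    by (intro borel_measurable_continuous_on_indicator contk) auto
  have ww [measurable]: "w \<in> borel_measurable borel"
    by (intro borel_measurable_continuous_onI contw)
  have f_alt2: "case_prod f = (\<lambda>p. (indicator {0..} (fst p) *\<^sub>R k (w (fst p))) *
     (indicator {0<..<\<rho>} (snd p) *\<^sub>R (exp (w (fst p) * of_real (ln \<rho> - ln (snd p))) * exp ((s0 - 1) * of_real (ln (snd p))))))"
    by (auto simp: f_def indicator_def)
  have meas: "case_prod f \<in> borel_measurable (lborel \<Otimes>\<^sub>M lborel)"
    unfolding f_alt2 by measurable
  have int2: "integrable lborel (\<lambda>x. f t x)" for t
  proof (cases "t \<ge> 0")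
    case True
    show ?thesis unfolding f_alt
      using exp_ln_integral(1) [OF Rew_pos [OF True] rho] unfolding set_integrable_def
      by (intro integrable_mult_right)
  qed (simp add: f_def)
  have norm_int: "(\<integral>x. norm (f t x) \<partial>lborel) =
      indicator {0..} t *\<^sub>R (exp (Re s0 * ln \<rho>) * (norm (k (w t)) / Re (s0 - w t)))" for t
  proof (cases "t \<ge> 0")
    case True
    have "(\<integral>x. norm (f t x) \<partial>lborel) = (\<integral>x. norm (k (w t) * exp (w t * of_real (ln \<rho>))) *
          (indicator {0<..<\<rho>} x *\<^sub>R norm (exp ((s0 - w t - 1) * of_real (ln x)))) \<partial>lborel)"
      unfolding f_alt using True by (intro Bochner_Integration.integral_cong) (auto simp: norm_mult)
    also have "\<dots> = norm (k (w t) * exp (w t * of_real (ln \<rho>))) * (exp (Re (s0 - w t) * ln \<rho>) / Re (s0 - w t))"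
      using exp_ln_integral(3) [OF Rew_pos [OF True] rho] by (simp add: set_lebesgue_integral_def)
    also have "\<dots> = exp (Re s0 * ln \<rho>) * (norm (k (w t)) / Re (s0 - w t))"
      by (simp add: norm_mult exp_diff left_diff_distrib)
    finally show ?thesis using True by simp
  qed (simp add: f_def)
  have "set_integrable lborel {0..} (\<lambda>t. exp (Re s0 * ln \<rho>) * (norm (k (w t)) / Re (s0 - w t)))"
  proof (rule set_integrable_atLeast0_bound)
    show "continuous_on {0..} (\<lambda>t. exp (Re s0 * ln \<rho>) * (norm (k (w t)) / Re (s0 - w t)))"
      using Rew_pos
      by (intro continuous_on_mult continuous_on_const continuous_on_divide continuous_on_norm contk
            continuous_on_Re continuous_on_diff contw) force+
    fix t :: real assume t: "t \<ge> 0"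
    show "norm (exp (Re s0 * ln \<rho>) * (norm (k (w t)) / Re (s0 - w t))) \<le> exp (Re s0 * ln \<rho>) * (K / h) / (1 + t)\<^sup>2"
      using mult_left_mono [OF dec [OF t], of "exp (Re s0 * ln \<rho>)"] Rew_pos [OF t] by (simp add: abs_mult)
  qed
  hence int1: "integrable lborel (\<lambda>t. \<integral>x. norm (f t x) \<partial>lborel)"
    unfolding norm_int set_integrable_def .
  have fint: "integrable (lborel \<Otimes>\<^sub>M lborel) (case_prod f)"
    by (rule lborel_pair.Fubini_integrable) (use meas int1 int2 in auto)
  have snd: "(\<integral>t. f t x \<partial>lborel) = indicator {0<..<\<rho>} x *\<^sub>R (J x * exp ((s0 - 1) * of_real (ln x)))" for x
  proof -
    have "(\<integral>t. f t x \<partial>lborel) = (\<integral>t. indicator {0<..<\<rho>} x *\<^sub>R ((indicator {0..} t *\<^sub>R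
      (k (w t) * exp (w t * of_real (ln \<rho> - ln x)))) * exp ((s0 - 1) * of_real (ln x))) \<partial>lborel)"
      by (intro Bochner_Integration.integral_cong) (auto simp: f_def)
    also have "\<dots> = indicator {0<..<\<rho>} x *\<^sub>R (J x * exp ((s0 - 1) * of_real (ln x)))"
      unfolding J_def set_lebesgue_integral_def w_def [symmetric]
      by (simp only: integral_scaleR_right integral_mult_left_zero)
    finally show ?thesis .
  qed
  have fst: "(\<integral>x. f t x \<partial>lborel) = indicator {0..} t *\<^sub>R (exp (s0 * of_real (ln \<rho>)) * (k (w t) / (s0 - w t)))" for t
  proof (cases "t \<ge> 0")
    case True
    have "(\<integral>x. f t x \<partial>lborel) = k (w t) * exp (w t * of_real (ln \<rho>)) * (exp ((s0 - w t) * of_real (ln \<rho>)) / (s0 - w t))"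
      unfolding f_alt integral_mult_right_zero using exp_ln_integral(2) [OF Rew_pos [OF True] rho] True
      by (simp add: set_lebesgue_integral_def)
    also have "\<dots> = exp (s0 * of_real (ln \<rho>)) * (k (w t) / (s0 - w t))"
      by (simp add: exp_diff left_diff_distrib)
    finally show ?thesis using True by simp
  qed (simp add: f_def)
  show ?B unfolding set_integrable_def snd [symmetric]
    by (rule lborel_pair.integrable_snd [OF fint])
  have "(\<integral>x. (\<integral>t. f t x \<partial>lborel) \<partial>lborel) = (\<integral>t. (\<integral>x. f t x \<partial>lborel) \<partial>lborel)"
    by (rule lborel_pair.Fubini_integral [OF fint])
  also have "\<dots> = (\<integral>t. exp (s0 * of_real (ln \<rho>)) * (indicator {0..} t *\<^sub>R (k (w t) / (s0 - w t))) \<partial>lborel)"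
    unfolding fst by (intro Bochner_Integration.integral_cong) auto
  finally show ?C unfolding set_lebesgue_integral_def snd w_def by (simp only: integral_mult_right_zero)
qed


section \<open>Cauchy's formula for the two rays\<close>

lemma Ln_diff_opposite:
  assumes "Im z < 0" "Im w > 0"
  shows "Ln (- z) - Ln (- w) = Ln z - Ln w + 2 * of_real pi * \<i>"
proof -
  have "z \<noteq> 0" "w \<noteq> 0" using assms by auto
  thus ?thesis using assms Ln_minus [of z] Ln_minus [of w] by (simp add: mult_ac)
qed

text \<open>The residue appears as a jump between two logarithms. Along the rays
  \<open>Ln (s0 - z)\<close> is a good choice, with its cut running from s0 to the right. A path
  closing the rays on the right has to cross that cut, so there \<open>Ln (z - s0)\<close> is used,
  whose cut runs to the left. \<open>Ln_diff_opposite\<close> gives the difference of the two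
  accounts.\<close>

lemma cauchy_wedge:
  assumes holo: "k holomorphic_on - (complex_of_real ` {..g})"
    and sec: "\<And>s. norm s \<ge> r \<Longrightarrow> Re s \<ge> - \<bar>Im s\<bar> \<Longrightarrow> norm (k s) \<le> C / norm s"
    and C: "C \<ge> 0" and d: "d > g" and s0: "Re s0 > d"
    and e1: "e1 = Complex (-1) 2" and e2: "e2 = Complex (-1) (-2)"
  shows "e1 * (LINT t:{0..}|lborel. k (ray d e1 t) / (s0 - ray d e1 t)) -
     e2 * (LINT t:{0..}|lborel. k (ray d e2 t) / (s0 - ray d e2 t)) = 2 * of_real pi * \<i> * k s0"
proof -
  define U where "U = - (complex_of_real ` {..g})"
  have U: "z \<in> U \<longleftrightarrow> Im z \<noteq> 0 \<or> Re z > g" for z unfolding U_def by (rule in_slit_plane_iff)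
  \<comment> \<open>Subtracting \<open>k s0\<close> removes the pole, so this part has a primitive
    in the whole slit plane and only \<open>1 / (z - s0)\<close> needs a logarithm.\<close>
  define q where "q = (\<lambda>z. if z = s0 then deriv k s0 else (k z - k s0) / (z - s0))"
  have hq: "q holomorphic_on - (complex_of_real ` {..g})"
    unfolding q_def by (rule pole_lemma_open [OF holo open_slit_plane])
  obtain Q where Q: "\<And>z. z \<in> U \<Longrightarrow> (Q has_field_derivative q z) (at z)"
    using slit_plane_primitive [OF hq] unfolding U_def by blast
  define \<Psi> where "\<Psi> = (\<lambda>e t. - (Q (ray d e t) + k s0 * Ln (s0 - ray d e t)))"
  have lim: "((\<lambda>T. \<Psi> e T - \<Psi> e 0) \<longlongrightarrow> e * (LINT t:{0..}|lborel. k (ray d e t) / (s0 - ray d e t))) at_top"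
    if e: "e \<in> {e1, e2}" for e
  proof -
    have e': "Re e = -1" "\<bar>Im e\<bar> = 2" "Im e \<noteq> 0" using e e1 e2 by auto
    have pos: "Re (s0 - ray d e t) > 0" if "t \<ge> 0" for t using that s0 e' by simp
    have nz: "s0 - ray d e t \<noteq> 0" if "t \<ge> 0" for t using pos [OF that] by auto
    have "((\<lambda>T. \<Psi> e T - \<Psi> e 0) \<longlongrightarrow> (LINT t:{0..}|lborel. e * (k (ray d e t) / (s0 - ray d e t)))) at_top"
    proof (rule tendsto_integral_antiderivative_at_top)
      show "continuous_on {0..} (\<lambda>t. e * (k (ray d e t) / (s0 - ray d e t)))"
        using nz e' by (intro continuous_intros continuous_on_ray_compose [OF holo d]) auto
      show "set_integrable lborel {0..} (\<lambda>t. e * (k (ray d e t) / (s0 - ray d e t)))"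
        using e' by (intro set_integrable_mult_right mellin_ray(1) [OF holo sec d _ _ s0 zero_less_one]) auto
      fix t :: real assume t: "t \<ge> 0"
      define w where "w = ray d e t"
      have w: "w \<in> U" "Re (s0 - w) > 0" "s0 - w \<noteq> 0"
        using ray_in_slit_plane [OF d e'(3) t] pos [OF t] nz [OF t] by (auto simp: w_def U_def)
      have "((\<lambda>z. - (Q z + k s0 * Ln (s0 - z))) has_field_derivative (- (q w + k s0 * (- 1 / (s0 - w))))) (at w)"
        using w Q [OF w(1)]
        by (auto intro!: derivative_eq_intros simp: complex_nonpos_Reals_iff divide_inverse mult.commute)
      also have "- (q w + k s0 * (- 1 / (s0 - w))) = k w / (s0 - w)"
        using w(3) by (auto simp: q_def divide_simps) (auto simp: algebra_simps)
      finally have "((\<lambda>z. - (Q z + k s0 * Ln (s0 - z))) has_field_derivative (k w / (s0 - w))) (at (ray d e t))"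
        by (simp add: w_def)
      from field_vector_diff_chain_at [OF has_vector_derivative_ray this]
      show "(\<Psi> e has_vector_derivative e * (k (ray d e t) / (s0 - ray d e t))) (at t)"
        by (simp add: o_def \<Psi>_def w_def)
    qed
    thus ?thesis by (simp only: set_integral_mult_right)
  qed
  define P where "P = (\<lambda>z. Q z + k s0 * Ln (z - s0))"
  \<comment> \<open>The entry with \<open>norm s0\<close> yields
    \<open>norm (z - s0) \<ge> T / 2\<close> on the closing path and keeps s0 to its left; the entry
    with d puts the path outside the slit and the ends of the rays within reach.\<close>
  define T0 where "T0 = max 1 (max r (max (2 * norm s0 + 1) (\<bar>d\<bar> + 1)))"
  have small: "norm (P (ray d e1 T) - P (ray d e2 T)) \<le> 24 * C * (1 / T)" if "T \<ge> T0" for T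
  proof -
    have T: "T \<ge> 1" "T \<ge> r" "T > 2 * norm s0" "T > \<bar>d\<bar>" using that by (auto simp: T0_def)
    have im0: "\<bar>Im s0\<bar> < T" "Re s0 < T"
      using T abs_Im_le_cmod [of s0] complex_Re_le_cmod [of s0] norm_ge_zero [of s0] by linarith+
    \<comment> \<open>The closing path consists of pieces of \<open>\<bar>Im z\<bar> = 2 * T\<close>
      and of \<open>Re z = T\<close>, all in the sector. The integrand is at most
      \<open>2 * C / T ^ 2\<close> there, and each of the three segments has length at most
      \<open>4 * T\<close>.\<close>
    have seg: "norm (P v - P u) \<le> 2 * C / T\<^sup>2 * norm (v - u)"
      if uv: "\<And>z. z \<in> closed_segment u v \<Longrightarrow> \<bar>Im z\<bar> = 2 * T \<and> Re z \<ge> - (2 * T) \<or> Re z = T" for u v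
    proof (rule primitive_segment_bound [where f = "\<lambda>z. k z / (z - s0)"])
      fix z assume z: "z \<in> closed_segment u v"
      note zz = uv [OF z]
      have zU: "z \<in> U" unfolding U using zz T d by auto
      have nz: "norm z \<ge> T" using zz abs_Re_le_cmod [of z] abs_Im_le_cmod [of z] T by auto
      have zs: "norm (z - s0) \<ge> T / 2"
        using norm_triangle_ineq2 [of z s0] nz T by linarith
      have ns: "z - s0 \<notin> \<real>\<^sub>\<le>\<^sub>0" using zz im0 T by (auto simp: complex_nonpos_Reals_iff)
      hence ne: "z \<noteq> s0" by auto
      have "(P has_field_derivative (q z + k s0 * (1 / (z - s0)))) (at z)"
        unfolding P_def using ns Q [OF zU] by (auto intro!: derivative_eq_intros simp: divide_inverse mult.commute)
      also have "q z + k s0 * (1 / (z - s0)) = k z / (z - s0)"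
        using ne by (simp add: q_def divide_simps)
      finally show "(P has_field_derivative k z / (z - s0)) (at z)" .
      have "norm (k z) \<le> C / norm z" using zz nz T by (intro sec) auto
      also have "\<dots> \<le> C / T" using nz T C by (intro divide_left_mono mult_pos_pos) auto
      finally have "norm (k z / (z - s0)) \<le> (C / T) / (T / 2)"
        unfolding norm_divide using zs T C by (intro frac_le) auto
      thus "norm (k z / (z - s0)) \<le> 2 * C / T\<^sup>2" by (simp add: power2_eq_square mult_ac)
    qed
    have fin: "norm (P v - P u) \<le> 8 * C * (1 / T)"
      if "norm (v - u) \<le> 4 * T"
        and "\<And>z. z \<in> closed_segment u v \<Longrightarrow> \<bar>Im z\<bar> = 2 * T \<and> Re z \<ge> - (2 * T) \<or> Re z = T" for u v
    proof -
      have "norm (P v - P u) \<le> 2 * C / T\<^sup>2 * norm (v - u)" by (rule seg [OF that(2)])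
      also have "\<dots> \<le> 2 * C / T\<^sup>2 * (4 * T)" using that(1) C by (intro mult_left_mono) auto
      also have "\<dots> = 8 * C * (1 / T)" using T by (simp add: power2_eq_square)
      finally show ?thesis .
    qed
    have r1: "ray d e1 T = Complex (d - T) (2 * T)" and r2: "ray d e2 T = Complex (d - T) (- 2 * T)"
      by (simp_all add: complex_eq_iff e1 e2)
    have 1: "norm (P (Complex T (- 2 * T)) - P (ray d e2 T)) \<le> 8 * C * (1 / T)"
    proof (rule fin)
      have "Complex T (- 2 * T) - ray d e2 T = of_real (2 * T - d)" by (simp add: r2 complex_eq_iff)
      thus "norm (Complex T (- 2 * T) - ray d e2 T) \<le> 4 * T" using T by (simp del: of_real_diff)
      show "\<bar>Im z\<bar> = 2 * T \<and> Re z \<ge> - (2 * T) \<or> Re z = T" if "z \<in> closed_segment (ray d e2 T) (Complex T (- 2 * T))" for z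
        using that T unfolding r2 by (auto simp: closed_segment_same_Im closed_segment_eq_real_ivl split: if_splits)
    qed
    have 2: "norm (P (Complex T (2 * T)) - P (Complex T (- 2 * T))) \<le> 8 * C * (1 / T)"
    proof (rule fin)
      have "Complex T (2 * T) - Complex T (- 2 * T) = of_real (4 * T) * \<i>" by (simp add: complex_eq_iff)
      thus "norm (Complex T (2 * T) - Complex T (- 2 * T)) \<le> 4 * T" using T by (simp add: norm_mult)
    qed (auto simp: closed_segment_same_Re)
    have 3: "norm (P (ray d e1 T) - P (Complex T (2 * T))) \<le> 8 * C * (1 / T)"
    proof (rule fin)
      have "ray d e1 T - Complex T (2 * T) = of_real (d - 2 * T)" by (simp add: r1 complex_eq_iff)
      thus "norm (ray d e1 T - Complex T (2 * T)) \<le> 4 * T" using T by (simp del: of_real_diff)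
      show "\<bar>Im z\<bar> = 2 * T \<and> Re z \<ge> - (2 * T) \<or> Re z = T" if "z \<in> closed_segment (Complex T (2 * T)) (ray d e1 T)" for z
        using that T unfolding r1 by (auto simp: closed_segment_same_Im closed_segment_eq_real_ivl split: if_splits)
    qed
    have "P (ray d e1 T) - P (ray d e2 T) = (P (ray d e1 T) - P (Complex T (2 * T)))
       + (P (Complex T (2 * T)) - P (Complex T (- 2 * T))) + (P (Complex T (- 2 * T)) - P (ray d e2 T))" by simp
    also have "norm \<dots> \<le> 8 * C * (1 / T) + 8 * C * (1 / T) + 8 * C * (1 / T)"
      by (intro norm_triangle_mono 1 2 3)
    finally show ?thesis by simp
  qed
  have "((\<lambda>T. P (ray d e1 T) - P (ray d e2 T)) \<longlongrightarrow> 0) at_top"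
  proof (rule Lim_null_comparison)
    show "\<forall>\<^sub>F T in at_top. norm (P (ray d e1 T) - P (ray d e2 T)) \<le> 24 * C * (1 / T)"
      using eventually_ge_at_top [of T0] by eventually_elim (rule small)
    have "((\<lambda>T. 24 * C * (1 / T)) \<longlongrightarrow> 24 * C * 0) at_top"
      by (intro tendsto_mult tendsto_const tendsto_divide_0 [OF tendsto_const]
           filterlim_at_top_imp_at_infinity filterlim_ident)
    thus "((\<lambda>T. 24 * C * (1 / T)) \<longlongrightarrow> 0) at_top" by simp
  qed
  hence "((\<lambda>T. 2 * of_real pi * \<i> * k s0 - (P (ray d e1 T) - P (ray d e2 T))) \<longlongrightarrow> 2 * of_real pi * \<i> * k s0 - 0) at_top"
    by (intro tendsto_diff tendsto_const)
  moreover have "eventually (\<lambda>T. 2 * of_real pi * \<i> * k s0 - (P (ray d e1 T) - P (ray d e2 T)) =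
      (\<Psi> e1 T - \<Psi> e1 0) - (\<Psi> e2 T - \<Psi> e2 0)) at_top"
    using eventually_gt_at_top [of "\<bar>Im s0\<bar>"]
  proof eventually_elim
    case (elim T)
    have "Ln (- (s0 - ray d e1 T)) - Ln (- (s0 - ray d e2 T)) = Ln (s0 - ray d e1 T) - Ln (s0 - ray d e2 T) + 2 * of_real pi * \<i>"
      using elim by (intro Ln_diff_opposite) (auto simp: e1 e2)
    hence *: "Ln (ray d e1 T - s0) = Ln (ray d e2 T - s0) + Ln (s0 - ray d e1 T) - Ln (s0 - ray d e2 T) + 2 * of_real pi * \<i>"
      by (simp add: algebra_simps)
    show ?case by (simp add: P_def \<Psi>_def * algebra_simps)
  qed
  ultimately have "((\<lambda>T. (\<Psi> e1 T - \<Psi> e1 0) - (\<Psi> e2 T - \<Psi> e2 0)) \<longlongrightarrow> 2 * of_real pi * \<i> * k s0 - 0) at_top"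
    by (rule Lim_transform_eventually)
  moreover have "((\<lambda>T. (\<Psi> e1 T - \<Psi> e1 0) - (\<Psi> e2 T - \<Psi> e2 0)) \<longlongrightarrow>
     e1 * (LINT t:{0..}|lborel. k (ray d e1 t) / (s0 - ray d e1 t)) -
     e2 * (LINT t:{0..}|lborel. k (ray d e2 t) / (s0 - ray d e2 t))) at_top"
    by (intro tendsto_diff lim) auto
  ultimately show ?thesis
    using tendsto_unique [OF trivial_limit_at_top_linorder] by fastforce
qed

lemma mellin_loop_integral:
  assumes holo: "k holomorphic_on - (complex_of_real ` {..g})"
    and sec: "\<And>s. norm s \<ge> r \<Longrightarrow> Re s \<ge> - \<bar>Im s\<bar> \<Longrightarrow> norm (k s) \<le> C / norm s"
    and strip: "\<And>s. norm s \<ge> r \<Longrightarrow> \<bar>Im s\<bar> \<ge> 1 \<Longrightarrow> norm (k s) \<le> C * norm s ^ m"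
    and C: "C \<ge> 0" and c: "c > g" and s0: "Re s0 > g" and rho: "\<rho> > 0"
  obtains \<Phi> where
    "\<And>x. x \<in> {0<..<\<rho>} \<Longrightarrow> ((\<lambda>R. contour_integral (trunc_loop c (- 1) 1 R)
        (\<lambda>s. k s * exp (s * of_real (ln \<rho> - ln x)))) \<longlongrightarrow> \<Phi> x) at_top"
    "set_integrable lborel {0<..<\<rho>} (\<lambda>x. \<Phi> x * exp ((s0 - 1) * of_real (ln x)))"
    "(LINT x:{0<..<\<rho>}|lborel. \<Phi> x * exp ((s0 - 1) * of_real (ln x))) =
       2 * of_real pi * \<i> * k s0 * exp (s0 * of_real (ln \<rho>))"
proof -
  \<comment> \<open>The rays must start to the right of the poles and to the left of s0. So d varies
    with s0, but the limit \<Phi> of the loop integrals does not depend on it.\<close>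
  define d where "d = (g + Re s0) / 2"
  have d: "d > g" "Re s0 > d" using s0 by (auto simp: d_def)
  define e1 e2 where "e1 = Complex (-1) 2" and "e2 = Complex (-1) (-2)"
  define J where "J = (\<lambda>e x. LINT t:{0..}|lborel. k (ray d e t) * exp (ray d e t * of_real (ln \<rho> - ln x)))"
  define \<Phi> where "\<Phi> = (\<lambda>x. e1 * J e1 x - e2 * J e2 x)"
  note ray = mellin_ray [OF holo sec d(1) _ _ d(2) rho]
  have int: "set_integrable lborel {0<..<\<rho>} (\<lambda>x. e * (J e x * exp ((s0 - 1) * of_real (ln x))))"
    if "e \<in> {e1, e2}" for e
    unfolding J_def using that by (intro set_integrable_mult_right ray(2)) (auto simp: e1_def e2_def)
  have val: "(LINT x:{0<..<\<rho>}|lborel. e * (J e x * exp ((s0 - 1) * of_real (ln x)))) =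
      exp (s0 * of_real (ln \<rho>)) * (e * (LINT t:{0..}|lborel. k (ray d e t) / (s0 - ray d e t)))"
    if "e \<in> {e1, e2}" for e
  proof -
    have "(LINT x:{0<..<\<rho>}|lborel. J e x * exp ((s0 - 1) * of_real (ln x))) =
      exp (s0 * of_real (ln \<rho>)) * (LINT t:{0..}|lborel. k (ray d e t) / (s0 - ray d e t))"
      unfolding J_def using that by (intro ray(3)) (auto simp: e1_def e2_def)
    thus ?thesis by simp
  qed
  have eq: "(\<lambda>x. \<Phi> x * exp ((s0 - 1) * of_real (ln x))) = (\<lambda>x. e1 * (J e1 x * exp ((s0 - 1) * of_real (ln x))) -
      e2 * (J e2 x * exp ((s0 - 1) * of_real (ln x))))"
    by (simp add: \<Phi>_def algebra_simps)
  show ?thesis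
  proof (rule that [of \<Phi>])
    show "((\<lambda>R. contour_integral (trunc_loop c (- 1) 1 R)
        (\<lambda>s. k s * exp (s * of_real (ln \<rho> - ln x)))) \<longlongrightarrow> \<Phi> x) at_top" if "x \<in> {0<..<\<rho>}" for x
      unfolding \<Phi>_def J_def using that
      by (intro loop_integral_tendsto [OF holo sec strip C d(1) c _ e1_def e2_def]) auto
    show "set_integrable lborel {0<..<\<rho>} (\<lambda>x. \<Phi> x * exp ((s0 - 1) * of_real (ln x)))"
      unfolding eq by (intro set_integral_diff int) auto
    have "(LINT x:{0<..<\<rho>}|lborel. \<Phi> x * exp ((s0 - 1) * of_real (ln x))) =
      exp (s0 * of_real (ln \<rho>)) * (e1 * (LINT t:{0..}|lborel. k (ray d e1 t) / (s0 - ray d e1 t)))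
     - exp (s0 * of_real (ln \<rho>)) * (e2 * (LINT t:{0..}|lborel. k (ray d e2 t) / (s0 - ray d e2 t)))"
      unfolding eq by (subst set_integral_diff) (simp_all only: int val insertI1 insertI2)
    also have "\<dots> = exp (s0 * of_real (ln \<rho>)) * (2 * of_real pi * \<i> * k s0)"
      unfolding right_diff_distrib [symmetric]
      by (subst cauchy_wedge [OF holo sec C d e1_def e2_def]) auto
    finally show "(LINT x:{0<..<\<rho>}|lborel. \<Phi> x * exp ((s0 - 1) * of_real (ln x))) =
       2 * of_real pi * \<i> * k s0 * exp (s0 * of_real (ln \<rho>))" by (simp add: mult_ac)
  qed
qed

section \<open>The Mellin transform of the H function\<close>

lemma contour_integrable_on_trunc_loop:
  assumes "f holomorphic_on - (complex_of_real ` {..g})" "c > g"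
  shows "f contour_integrable_on trunc_loop c (- 1) 1 R"
  using slit_plane_primitive [OF assms(1)] contour_integral_trunc_loop_primitive [OF _ assms(2)]
  by (metis has_contour_integral_integrable)

theorem theorem2:
  fixes p q :: nat and A a B b :: "nat \<Rightarrow> real" and m :: nat
  assumes "p \<ge> 1" and "q \<ge> 1"
    and "\<And>k. k < p \<Longrightarrow> A k > 0"
    and "\<And>j. j < q \<Longrightarrow> B j > 0"
    and "(\<Sum>j<q. B j) - (\<Sum>k<p. A k) = 0"
    and "H_mu p q a b = - real m"
  shows "\<forall>s::complex. Re s > H_gamma p A a \<longrightarrow>
    (\<lambda>x. FoxH p q A a B b x * of_real x powr (s - 1)) absolutely_integrable_on {0<..<H_rho p q A B} \<and>
    ((\<lambda>x. FoxH p q A a B b x * of_real x powr (s - 1)) has_integral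
       (H_kernel p q A a B b s
        - of_real (H_nu p q A a B b) * of_real (H_rho p q A B) powr s
          * (\<Sum>k\<le>m. of_real (H_lcoef p q A a B b (m - k)) * s ^ k)))
      {0<..<H_rho p q A B}"
proof (intro allI impI)
  fix s0 :: complex assume s0: "Re s0 > H_gamma p A a"
  define \<gamma> where "\<gamma> = H_gamma p A a"
  define \<rho> where "\<rho> = H_rho p q A B"
  define \<nu> where "\<nu> = H_nu p q A a B b"
  define l where "l = (\<lambda>k. complex_of_real (H_lcoef p q A a B b (m - k)))"
  define k where "k = H_remainder p q A a B b m"
  note AB = assms(3,4)
  have rho: "\<rho> > 0" unfolding \<rho>_def by (rule ln_H_rho(1)) (use AB in auto)
  have k: "k s = H_kernel p q A a B b s * exp (- s * of_real (ln \<rho>)) - of_real \<nu> * (\<Sum>i\<le>m. l i * s ^ i)" for s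
    by (simp add: k_def H_remainder_def \<rho>_def \<nu>_def l_def)
  have holo: "k holomorphic_on - (complex_of_real ` {..\<gamma>})"
    unfolding k_def \<gamma>_def by (rule H_remainder_holomorphic) (use AB in auto)
  obtain r1 C1 where 1: "C1 \<ge> 0" "\<And>s. norm s \<ge> r1 \<Longrightarrow> Re s \<ge> - \<bar>Im s\<bar> \<Longrightarrow> norm (k s) \<le> C1 / norm s"
    using H_remainder_sector_bound [of p A q B a b m] AB assms(5,6) unfolding k_def by blast
  obtain r2 C2 where 2: "C2 \<ge> 0" "\<And>s. norm s \<ge> r2 \<Longrightarrow> \<bar>Im s\<bar> \<ge> 1 \<Longrightarrow> norm (k s) \<le> C2 * norm s ^ m"
    using H_remainder_strip_bound [of p A q B a b m] AB assms(5,6) unfolding k_def by blast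
  define r C where "r = max r1 r2" and "C = max C1 C2"
  have sec: "norm (k s) \<le> C / norm s" if "norm s \<ge> r" "Re s \<ge> - \<bar>Im s\<bar>" for s
  proof -
    have "norm (k s) \<le> C1 / norm s" using that by (intro 1(2)) (auto simp: r_def)
    also have "\<dots> \<le> C / norm s" by (intro divide_right_mono) (auto simp: C_def)
    finally show ?thesis .
  qed
  have strip: "norm (k s) \<le> C * norm s ^ m" if "norm s \<ge> r" "\<bar>Im s\<bar> \<ge> 1" for s
  proof -
    have "norm (k s) \<le> C2 * norm s ^ m" using that by (intro 2(2)) (auto simp: r_def)
    also have "\<dots> \<le> C * norm s ^ m" by (intro mult_right_mono) (auto simp: C_def)
    finally show ?thesis .
  qed
  have C: "C \<ge> 0" using 1(1) by (simp add: C_def)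
  have c: "\<gamma> + 1 > \<gamma>" by simp
  obtain \<Phi> where \<Phi>: "\<And>x. x \<in> {0<..<\<rho>} \<Longrightarrow> ((\<lambda>R. contour_integral (trunc_loop (\<gamma> + 1) (- 1) 1 R)
        (\<lambda>s. k s * exp (s * of_real (ln \<rho> - ln x)))) \<longlongrightarrow> \<Phi> x) at_top"
    and int: "set_integrable lborel {0<..<\<rho>} (\<lambda>x. \<Phi> x * exp ((s0 - 1) * of_real (ln x)))"
    and val: "(LINT x:{0<..<\<rho>}|lborel. \<Phi> x * exp ((s0 - 1) * of_real (ln x))) =
       2 * of_real pi * \<i> * k s0 * exp (s0 * of_real (ln \<rho>))"
    using mellin_loop_integral [OF holo sec strip C c s0 [folded \<gamma>_def] rho] by blast
  have Fox: "FoxH p q A a B b x = \<Phi> x / (2 * of_real pi * \<i>)" if x: "x \<in> {0<..<\<rho>}" for x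
  proof -
    define L where "L = ln \<rho> - ln x"
    have L: "L > 0" using x by (simp add: L_def)
    \<comment> \<open>\<open>x powr (- s)\<close> is \<open>\<rho> powr (- s)\<close> times
      \<open>exp (s * L)\<close>. The first factor turns the kernel into remainder plus polynomial;
      the second decays to the left because \<open>x < \<rho>\<close>.\<close>
    have split: "H_kernel p q A a B b s * of_real x powr (- s) =
        k s * exp (s * of_real L) + (\<Sum>i\<le>m. (of_real \<nu> * l i) * s ^ i) * exp (s * of_real L)" for s
    proof -
      have "of_real x powr (- s) = exp (- s * of_real (ln \<rho>)) * exp (s * of_real L)"
        using x by (simp add: powr_def Ln_of_real L_def algebra_simps flip: exp_add)
      thus ?thesis by (simp add: k sum_distrib_left ring_distribs mult_ac)
    qed
    have "((\<lambda>R. contour_integral (trunc_loop (\<gamma> + 1) (- 1) 1 R) (\<lambda>s. k s * exp (s * of_real L)) +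
        contour_integral (trunc_loop (\<gamma> + 1) (- 1) 1 R) (\<lambda>s. (\<Sum>i\<le>m. (of_real \<nu> * l i) * s ^ i) * exp (s * of_real L)))
        \<longlongrightarrow> \<Phi> x + 0) at_top"
      unfolding L_def using L [unfolded L_def] x by (intro tendsto_add \<Phi> loop_integral_polynomial_tendsto_0)
    also have "(\<lambda>R. contour_integral (trunc_loop (\<gamma> + 1) (- 1) 1 R) (\<lambda>s. k s * exp (s * of_real L)) +
        contour_integral (trunc_loop (\<gamma> + 1) (- 1) 1 R) (\<lambda>s. (\<Sum>i\<le>m. (of_real \<nu> * l i) * s ^ i) * exp (s * of_real L))) =
       (\<lambda>R. contour_integral (trunc_loop (H_gamma p A a + 1) (- 1) 1 R) (\<lambda>s. H_kernel p q A a B b s * of_real x powr (- s)))"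
      unfolding split \<gamma>_def [symmetric]
      by (intro ext contour_integral_add [symmetric] contour_integrable_on_trunc_loop [OF _ c] holomorphic_intros holo)
    finally show ?thesis
      unfolding FoxH_def by (subst tendsto_Lim) auto
  qed
  define f where "f = (\<lambda>x. FoxH p q A a B b x * of_real x powr (s0 - 1))"
  have f: "f x = \<Phi> x * exp ((s0 - 1) * of_real (ln x)) / (2 * of_real pi * \<i>)" if "x \<in> {0<..<\<rho>}" for x
    using that Fox [OF that] by (simp add: f_def powr_def Ln_of_real)
  have fint: "set_integrable lborel {0<..<\<rho>} f"
    by (subst set_integrable_cong [OF refl refl f]) (use int in \<open>auto intro: set_integrable_divide\<close>)
  have "(LINT x:{0<..<\<rho>}|lborel. f x) = (LINT x:{0<..<\<rho>}|lborel. \<Phi> x * exp ((s0 - 1) * of_real (ln x)) / (2 * of_real pi * \<i>))"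
    using f by (intro set_lebesgue_integral_cong) auto
  also have "\<dots> = k s0 * exp (s0 * of_real (ln \<rho>))"
    by (simp add: val)
  also have "\<dots> = H_kernel p q A a B b s0 - of_real \<nu> * of_real \<rho> powr s0 * (\<Sum>i\<le>m. l i * s0 ^ i)"
    using rho by (simp add: k powr_def Ln_of_real algebra_simps exp_minus)
  finally have fval: "(LINT x:{0<..<\<rho>}|lborel. f x) =
      H_kernel p q A a B b s0 - of_real \<nu> * of_real \<rho> powr s0 * (\<Sum>i\<le>m. l i * s0 ^ i)" .
  \<comment> \<open>Absolute integrability refers to the completed measure, whereas Fubini's theorem
    was applied to \<open>lborel\<close>.\<close>
  have "f absolutely_integrable_on {0<..<\<rho>}"
    using fint unfolding set_integrable_def
    by (subst integrable_completion) (auto dest: borel_measurable_integrable)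
  moreover have "(f has_integral (LINT x:{0<..<\<rho>}|lborel. f x)) {0<..<\<rho>}"
    using set_borel_integral_eq_integral [OF fint] by (simp add: has_integral_iff)
  ultimately show "(\<lambda>x. FoxH p q A a B b x * of_real x powr (s0 - 1)) absolutely_integrable_on {0<..<H_rho p q A B} \<and>
    ((\<lambda>x. FoxH p q A a B b x * of_real x powr (s0 - 1)) has_integral
       (H_kernel p q A a B b s0
        - of_real (H_nu p q A a B b) * of_real (H_rho p q A B) powr s0
          * (\<Sum>k\<le>m. of_real (H_lcoef p q A a B b (m - k)) * s0 ^ k)))
      {0<..<H_rho p q A B}"
    unfolding fval by (simp add: f_def \<rho>_def \<nu>_def l_def)
qed

end
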